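(* Let $\Gamma$ be a graph and let $\mathcal{D}$ be the set of dimer coverings of $\Gamma$. The dimer complex $X_{\mathcal{D}}$ of $\Gamma$ is nonpositively curved.
   Context: A graph is a 1-dimensional CW-complex without loops (multiple edges are allowed). Let $E$ be the set of edges of $\Gamma$ and let $G=2^E$ be the power group of $E$: the set of subsets of $E$ with multiplication $AB=(A\cup B)\setminus(A\cap B)$. A dimer covering is a set of edges such that every vertex of $\Gamma$ is incident to exactly one edge in the set. Let $\mathcal{D}\subset G$ be the set of dimer coverings. A set $s\subset E$ is cyclic if it is finite and each vertex of $\Gamma$ is either incident to exactly two distinct edges belonging to $s$ or not incident to any edge belonging to $s$. A cyclic set is a cycle if the union of its edges is a single circle; a cycle is even if it has an even number of elements. Two sets of edges $s,t\subset E$ are independent if no edge in $s$ has a common vertex with an edge in $t$. For a finite set $S$ of pairwise independent even cycles, put $[S]=\prod_{s\in S}s\in G$ (the union of the cycles), $[\emptyset]=\emptyset$. A based cube is a pair $(A,S)$ with $A\in G$ and $S$ a finite set of pairwise independent even cycles; its vertices are the elements $[T]A$, $T\subset S$, and its dimension is $\mathrm{card}(S)$. Based cubes $(A,S)$ and $([T]A,S)$ with $T\subset S$ are equivalent; equivalence classes of $k$-dimensional based cubes are called $k$-cubes in $G$. A cube $Q$ is a face of a cube $Q'$ if they are represented by based cubes $(A,S)$, $(A,S')$ with $S\subset S'$. The cubed complex $X_G$ has one copy of $[0,1]^k$ for each $k$-cube in $G$, glued along inclusions of cubes as faces. Precisely, points of $X_G$ are represented by triples $(A,S,x)$ with $(A,S)$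 a based cube and $x:S\to[0,1]$, modulo the equivalence relation generated by: $(A,S,x)\sim(A,S',x')$ if $S\subset S'$, $x=x'|_S$, $x'(S'\setminus S)=0$; and $(A,S,x)\sim([T]A,S,x')$ if $T\subset S$, $x'=x$ on $S\setminus T$ and $x'(t)=1-x(t)$ for $t\in T$. The dimer complex $X_{\mathcal{D}}\subset X_G$ is the subcomplex formed by the cubes all of whose vertices lie in $\mathcal{D}$. The link of a $0$-cell $A$ of a cubed complex is the space of directions at $A$; each triple ($k\ge1$, a vertex $a$ of $[0,1]^k$, a $k$-cell carrying $a$ to $A$) determines a $(k-1)$-dimensional simplex in it. A cubed complex is simple if the links of all $0$-cells are simplicial complexes, i.e. all these simplices are embedded and the intersection of any two is a common face. A flag complex is a simplicial complex in which any finite collection of pairwise adjacent vertices spans a simplex. A cubed complex is nonpositively curved if it is simple and the link of each $0$-cell is a flag complex. *)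

theory Defs
  imports "HOL-Analysis.Analysis" "HOL-Algebra.FiniteProduct"
begin

section \<open>Cubed complexes\<close>

text \<open>The cube \<open>[0,1]\<^sup>k\<close> is represented as \<open>[0,1]\<^sup>I\<close> for a finite index set \<open>I\<close> with \<open>k\<close> elements,
  i.e. as a set of functions that are \<open>undefined\<close> outside \<open>I\<close>.\<close>

definition cube :: "'i set \<Rightarrow> ('i \<Rightarrow> real) set" where
  "cube I = (\<Pi>\<^sub>E i\<in>I. {0..1})"

definition open_cube :: "'i set \<Rightarrow> ('i \<Rightarrow> real) set" where
  "open_cube I = (\<Pi>\<^sub>E i\<in>I. {0<..<1})"

definition cube_corners :: "'i set \<Rightarrow> ('i \<Rightarrow> real) set" where
  "cube_corners I = (\<Pi>\<^sub>E i\<in>I. {0, 1})"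

definition cube_facet :: "'i set \<Rightarrow> 'i \<Rightarrow> real \<Rightarrow> ('i \<Rightarrow> real) set" where
  "cube_facet I i \<epsilon> = {x \<in> cube I. x i = \<epsilon>}"

definition cube_topology :: "'i set \<Rightarrow> ('i \<Rightarrow> real) topology" where
  "cube_topology I = product_topology (\<lambda>_. top_of_set {0..1}) I"

definition cube_isometry ::
  "'i set \<Rightarrow> 'i set \<Rightarrow> (('i \<Rightarrow> real) \<Rightarrow> ('i \<Rightarrow> real)) \<Rightarrow> ('i \<Rightarrow> real) set \<Rightarrow> ('i \<Rightarrow> real) set \<Rightarrow> bool"
where
  "cube_isometry I J h F F' \<longleftrightarrow>
     bij_betw h F F' \<and>
     (\<forall>x\<in>F. \<forall>y\<in>F. L2_set (\<lambda>j. h x j - h y j) J = L2_set (\<lambda>i. x i - y i) I)"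

text \<open>\<open>cells\<close> is a set of names for the cells; a cell \<open>c\<close> is the map
  \<open>char_map c\<close> from \<open>cube (coords c)\<close> to the underlying space.\<close>

record ('c, 'i, 'x) cubed_space =
  underlying :: "'x topology"
  cells :: "'c set"
  coords :: "'c \<Rightarrow> 'i set"
  char_map :: "'c \<Rightarrow> ('i \<Rightarrow> real) \<Rightarrow> 'x"

text \<open>A CW-complex whose closed cells are cubes, attached along their facets by isometries onto
  cells of one dimension less.  Since the attaching maps are cellular in this strong sense, the
  CW-structure amounts to the decomposition into disjoint open cells together with the weak
  topology; in particular, continuity of the cells is contained in the last clause.\<close>

definition cubed_complex :: "('c, 'i, 'x) cubed_space \<Rightarrow> bool" where
  "cubed_complex X \<longleftrightarrow>
     (\<forall>c\<in>cells X. finite (coords X c)) \<and>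
     (\<forall>c\<in>cells X. inj_on (char_map X c) (open_cube (coords X c))) \<and>
     (\<forall>c\<in>cells X. \<forall>d\<in>cells X. c \<noteq> d \<longrightarrow>
        char_map X c ` open_cube (coords X c) \<inter> char_map X d ` open_cube (coords X d) = {}) \<and>
     topspace (underlying X) = (\<Union>c\<in>cells X. char_map X c ` open_cube (coords X c)) \<and>
     (\<forall>c\<in>cells X. \<forall>i\<in>coords X c. \<forall>\<epsilon>\<in>{0, 1}.
        \<exists>d\<in>cells X. \<exists>h. card (coords X c) = Suc (card (coords X d)) \<and>
          cube_isometry (coords X c) (coords X d) h
            (cube_facet (coords X c) i \<epsilon>) (cube (coords X d)) \<and>
          (\<forall>x\<in>cube_facet (coords X c) i \<epsilon>. char_map X c x = char_map X d (h x))) \<and>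
     (\<forall>U. openin (underlying X) U \<longleftrightarrow>
        U \<subseteq> topspace (underlying X) \<and>
        (\<forall>c\<in>cells X. openin (cube_topology (coords X c))
           {x \<in> cube (coords X c). char_map X c x \<in> U}))"

definition zero_cells :: "('c, 'i, 'x) cubed_space \<Rightarrow> 'x set" where
  "zero_cells X = (\<Union>c\<in>{c \<in> cells X. coords X c = {}}. char_map X c ` cube (coords X c))"

definition subcomplex :: "('c, 'i, 'x) cubed_space \<Rightarrow> 'c set \<Rightarrow> ('c, 'i, 'x) cubed_space" where
  "subcomplex X K =
     X\<lparr>underlying := subtopology (underlying X) (\<Union>c\<in>K. char_map X c ` cube (coords X c)),
       cells := K\<rparr>"

subsection \<open>Links\<close>

text \<open>A direction is the germ at \<open>0\<close> of a straight ray \<open>t \<mapsto> a \<plusminus> t v\<close> that leaves a corner \<open>a\<close> of a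
  cube into this cube, carried to the complex by the cell.  Rays are considered up to rescaling of
  time; the normalisation chosen is that the (absolute) velocities \<open>v\<^sub>i \<ge> 0\<close> add up to \<open>1\<close>, so that
  the directions at \<open>a\<close> in a \<open>k\<close>-cube are the points of the standard \<open>(k - 1)\<close>-simplex.\<close>

definition std_simplex :: "'i set \<Rightarrow> ('i \<Rightarrow> real) set" where
  "std_simplex I = {v \<in> (\<Pi>\<^sub>E i\<in>I. {0..}). (\<Sum>i\<in>I. v i) = 1}"

definition std_face :: "'i set \<Rightarrow> 'i set \<Rightarrow> ('i \<Rightarrow> real) set" where
  "std_face I J = {v \<in> std_simplex I. \<forall>i\<in>I - J. v i = 0}"

definition ray :: "'i set \<Rightarrow> ('i \<Rightarrow> real) \<Rightarrow> ('i \<Rightarrow> real) \<Rightarrow> real \<Rightarrow> ('i \<Rightarrow> real)" where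
  "ray I a v t = (\<lambda>i\<in>I. a i + t * (1 - 2 * a i) * v i)"

definition germ :: "(real \<Rightarrow> 'x) \<Rightarrow> (real \<Rightarrow> 'x) set" where
  "germ \<gamma> = {\<delta>. eventually (\<lambda>t. \<delta> t = \<gamma> t) (at_right 0)}"

definition direction ::
  "('c, 'i, 'x) cubed_space \<Rightarrow> 'c \<Rightarrow> ('i \<Rightarrow> real) \<Rightarrow> ('i \<Rightarrow> real) \<Rightarrow> (real \<Rightarrow> 'x) set"
where
  "direction X c a v = germ (\<lambda>t. char_map X c (ray (coords X c) a v t))"

text \<open>The pairs of a cell \<open>c\<close> of dimension \<open>k \<ge> 1\<close> and a corner \<open>a\<close> of its cube carried to \<open>A\<close>.\<close>

definition link_data :: "('c, 'i, 'x) cubed_space \<Rightarrow> 'x \<Rightarrow> ('c \<times> ('i \<Rightarrow> real)) set" where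
  "link_data X A = {(c, a). c \<in> cells X \<and> coords X c \<noteq> {} \<and>
     a \<in> cube_corners (coords X c) \<and> char_map X c a = A}"

definition link_face ::
  "('c, 'i, 'x) cubed_space \<Rightarrow> 'c \<Rightarrow> ('i \<Rightarrow> real) \<Rightarrow> 'i set \<Rightarrow> (real \<Rightarrow> 'x) set set"
where
  "link_face X c a J = direction X c a ` std_face (coords X c) J"

definition link_simplex ::
  "('c, 'i, 'x) cubed_space \<Rightarrow> 'c \<Rightarrow> ('i \<Rightarrow> real) \<Rightarrow> (real \<Rightarrow> 'x) set set"
where
  "link_simplex X c a = direction X c a ` std_simplex (coords X c)"

text \<open>As usual, the empty set (\<open>J = {}\<close> below) counts as a face of every simplex.\<close>

definition link_simplicial :: "('c, 'i, 'x) cubed_space \<Rightarrow> 'x \<Rightarrow> bool" where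
  "link_simplicial X A \<longleftrightarrow>
     (\<forall>(c, a)\<in>link_data X A. inj_on (direction X c a) (std_simplex (coords X c))) \<and>
     (\<forall>(c, a)\<in>link_data X A. \<forall>(d, b)\<in>link_data X A.
        \<exists>J J'. J \<subseteq> coords X c \<and> J' \<subseteq> coords X d \<and>
          link_simplex X c a \<inter> link_simplex X d b = link_face X c a J \<and>
          link_simplex X c a \<inter> link_simplex X d b = link_face X d b J')"

definition simple_cubed_complex :: "('c, 'i, 'x) cubed_space \<Rightarrow> bool" where
  "simple_cubed_complex X \<longleftrightarrow> cubed_complex X \<and> (\<forall>A\<in>zero_cells X. link_simplicial X A)"

definition link_simplex_vertices ::
  "('c, 'i, 'x) cubed_space \<Rightarrow> 'c \<Rightarrow> ('i \<Rightarrow> real) \<Rightarrow> (real \<Rightarrow> 'x) set set"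
where
  "link_simplex_vertices X c a = (\<Union>i\<in>coords X c. link_face X c a {i})"

text \<open>The link as an abstract simplicial complex: the vertex sets of its simplices.\<close>

definition link_complex :: "('c, 'i, 'x) cubed_space \<Rightarrow> 'x \<Rightarrow> (real \<Rightarrow> 'x) set set set" where
  "link_complex X A = (\<lambda>(c, a). link_simplex_vertices X c a) ` link_data X A"

definition flag_complex :: "'a set set \<Rightarrow> bool" where
  "flag_complex K \<longleftrightarrow>
     (\<forall>U. finite U \<and> U \<noteq> {} \<and> U \<subseteq> \<Union>K \<and> pairwise (\<lambda>u w. {u, w} \<in> K) U \<longrightarrow> U \<in> K)"

definition nonpositively_curved :: "('c, 'i, 'x) cubed_space \<Rightarrow> bool" where
  "nonpositively_curved X \<longleftrightarrow>
     simple_cubed_complex X \<and> (\<forall>A\<in>zero_cells X. flag_complex (link_complex X A))"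


section \<open>Graphs, dimer coverings and cycles\<close>

record ('v, 'e) multigraph =
  verts :: "'v set"
  edges :: "'e set"
  ends :: "'e \<Rightarrow> 'v set"

text \<open>Multiple edges are allowed, loops are not; no finiteness is assumed.\<close>

definition is_graph :: "('v, 'e) multigraph \<Rightarrow> bool" where
  "is_graph \<Gamma> \<longleftrightarrow> (\<forall>e\<in>edges \<Gamma>. ends \<Gamma> e \<subseteq> verts \<Gamma> \<and> card (ends \<Gamma> e) = 2)"

definition power_group :: "'e set \<Rightarrow> 'e set monoid" where
  "power_group E = \<lparr>carrier = Pow E, mult = (\<lambda>A B. (A \<union> B) - (A \<inter> B)), one = {}\<rparr>"

definition dimer_coverings :: "('v, 'e) multigraph \<Rightarrow> 'e set set" where
  "dimer_coverings \<Gamma> = {A. A \<subseteq> edges \<Gamma> \<and> (\<forall>v\<in>verts \<Gamma>. \<exists>!e. e \<in> A \<and> v \<in> ends \<Gamma> e)}"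

definition cyclic_set :: "('v, 'e) multigraph \<Rightarrow> 'e set \<Rightarrow> bool" where
  "cyclic_set \<Gamma> s \<longleftrightarrow> s \<subseteq> edges \<Gamma> \<and> finite s \<and>
     (\<forall>v\<in>verts \<Gamma>. card {e \<in> s. v \<in> ends \<Gamma> e} = 2 \<or> {e \<in> s. v \<in> ends \<Gamma> e} = {})"

text \<open>The union of the edges in \<open>s\<close> is a single circle, passing through pairwise distinct vertices
  \<open>p 0, \<dots>, p (n - 1)\<close> along pairwise distinct edges \<open>q 0, \<dots>, q (n - 1)\<close>.  For \<open>n = 2\<close> this is a pair
  of parallel edges.\<close>

definition forms_circle :: "('v, 'e) multigraph \<Rightarrow> 'e set \<Rightarrow> bool" where
  "forms_circle \<Gamma> s \<longleftrightarrow> (\<exists>n (p :: nat \<Rightarrow> 'v) (q :: nat \<Rightarrow> 'e).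
     2 \<le> n \<and> inj_on p {..<n} \<and> bij_betw q {..<n} s \<and>
     (\<forall>i<n. ends \<Gamma> (q i) = {p i, p (Suc i mod n)}))"

definition even_cycle :: "('v, 'e) multigraph \<Rightarrow> 'e set \<Rightarrow> bool" where
  "even_cycle \<Gamma> s \<longleftrightarrow> cyclic_set \<Gamma> s \<and> forms_circle \<Gamma> s \<and> even (card s)"

definition independent_edge_sets :: "('v, 'e) multigraph \<Rightarrow> 'e set \<Rightarrow> 'e set \<Rightarrow> bool" where
  "independent_edge_sets \<Gamma> s t \<longleftrightarrow> (\<forall>e\<in>s. \<forall>f\<in>t. ends \<Gamma> e \<inter> ends \<Gamma> f = {})"


section \<open>The complexes of the power group and of dimer coverings\<close>

type_synonym 'e based_cube = "'e set \<times> 'e set set"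
type_synonym 'e based_point = "'e set \<times> 'e set set \<times> ('e set \<Rightarrow> real)"

definition based_cubes :: "('v, 'e) multigraph \<Rightarrow> 'e based_cube set" where
  "based_cubes \<Gamma> = {(A, S). A \<in> carrier (power_group (edges \<Gamma>)) \<and> finite S \<and>
     (\<forall>s\<in>S. even_cycle \<Gamma> s) \<and> pairwise (independent_edge_sets \<Gamma>) S}"

text \<open>\<open>glide \<Gamma> T A\<close> is the element \<open>[T]A\<close> of the power group.\<close>

definition glide :: "('v, 'e) multigraph \<Rightarrow> 'e set set \<Rightarrow> 'e set \<Rightarrow> 'e set" where
  "glide \<Gamma> T A = finprod (power_group (edges \<Gamma>)) (\<lambda>s. s) T \<otimes>\<^bsub>power_group (edges \<Gamma>)\<^esub> A"

definition based_cube_rel :: "('v, 'e) multigraph \<Rightarrow> ('e based_cube \<times> 'e based_cube) set" where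
  "based_cube_rel \<Gamma> = {((A, S), (glide \<Gamma> T A, S)) |A S T. (A, S) \<in> based_cubes \<Gamma> \<and> T \<subseteq> S}"

definition group_cubes :: "('v, 'e) multigraph \<Rightarrow> 'e based_cube set set" where
  "group_cubes \<Gamma> = based_cubes \<Gamma> // based_cube_rel \<Gamma>"

definition cube_vertices :: "('v, 'e) multigraph \<Rightarrow> 'e based_cube set \<Rightarrow> 'e set set" where
  "cube_vertices \<Gamma> Q = {glide \<Gamma> T A |A S T. (A, S) \<in> Q \<and> T \<subseteq> S}"

inductive glue :: "('v, 'e) multigraph \<Rightarrow> 'e based_point \<Rightarrow> 'e based_point \<Rightarrow> bool"
  for \<Gamma> :: "('v, 'e) multigraph" where
  face: "(A, S') \<in> based_cubes \<Gamma> \<Longrightarrow> S \<subseteq> S' \<Longrightarrow> x' \<in> cube S' \<Longrightarrow> x = restrict x' S \<Longrightarrow>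
     (\<And>s. s \<in> S' - S \<Longrightarrow> x' s = 0) \<Longrightarrow> glue \<Gamma> (A, S, x) (A, S', x')"
| rebase: "(A, S) \<in> based_cubes \<Gamma> \<Longrightarrow> T \<subseteq> S \<Longrightarrow> x \<in> cube S \<Longrightarrow> x' \<in> cube S \<Longrightarrow>
     (\<And>s. s \<in> S - T \<Longrightarrow> x' s = x s) \<Longrightarrow> (\<And>t. t \<in> T \<Longrightarrow> x' t = 1 - x t) \<Longrightarrow>
     glue \<Gamma> (A, S, x) (glide \<Gamma> T A, S, x')"

definition glued_point ::
  "('v, 'e) multigraph \<Rightarrow> 'e based_point \<Rightarrow> 'e based_point set"
where
  "glued_point \<Gamma> r = {r'. equivclp (glue \<Gamma>) r r'}"

definition group_points :: "('v, 'e) multigraph \<Rightarrow> 'e based_point set set" where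
  "group_points \<Gamma> = {glued_point \<Gamma> (A, S, x) |A S x. (A, S) \<in> based_cubes \<Gamma> \<and> x \<in> cube S}"

text \<open>The quotient topology from the disjoint union of the cubes \<open>[0,1]\<^sup>S\<close> over all based cubes.\<close>

definition group_topology :: "('v, 'e) multigraph \<Rightarrow> 'e based_point set topology" where
  "group_topology \<Gamma> = topology (\<lambda>U. U \<subseteq> group_points \<Gamma> \<and>
     (\<forall>(A, S)\<in>based_cubes \<Gamma>.
        openin (cube_topology S) {x \<in> cube S. glued_point \<Gamma> (A, S, x) \<in> U}))"

text \<open>There is one cell for each cube.  To write it as a map on \<open>[0,1]\<^sup>S\<close>, one of the \<open>2\<^sup>k\<close> based
  cubes that represent the cube has to be chosen; another choice changes the cell by an isometry
  of \<open>[0,1]\<^sup>S\<close>.\<close>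

definition representative :: "'e based_cube set \<Rightarrow> 'e based_cube" where
  "representative Q = (SOME r. r \<in> Q)"

definition group_complex ::
  "('v, 'e) multigraph \<Rightarrow> ('e based_cube set, 'e set, 'e based_point set) cubed_space"
where
  "group_complex \<Gamma> =
     \<lparr>underlying = group_topology \<Gamma>,
      cells = group_cubes \<Gamma>,
      coords = (\<lambda>Q. snd (representative Q)),
      char_map = (\<lambda>Q x. glued_point \<Gamma> (fst (representative Q), snd (representative Q), x))\<rparr>"

definition dimer_complex ::
  "('v, 'e) multigraph \<Rightarrow> ('e based_cube set, 'e set, 'e based_point set) cubed_space"
where
  "dimer_complex \<Gamma> = subcomplex (group_complex \<Gamma>)
     {Q \<in> group_cubes \<Gamma>. cube_vertices \<Gamma> Q \<subseteq> dimer_coverings \<Gamma>}"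

end

theory Submission
  imports Defs
begin

text \<open>
  Coordinates make the gluing transparent.  Extend the coordinates \<open>x\<close> of a point \<open>(A, S, x)\<close> by zero
  to all sets of edges.  Gluing a face does not change the pair of \<open>A\<close> and the extended function, and
  rebasing by \<open>T\<close> replaces \<open>A\<close> by \<open>[T]A\<close> and each coordinate \<open>x t\<close> with \<open>t \<in> T\<close> by \<open>1 - x t\<close>.  This
  is an action of the group of finite sets \<open>T\<close>, and two points are glued if and only if they are in
  the same orbit (\<open>glued_point_eq_iff\<close>).  An interior point of a cube has coordinates strictly
  between \<open>0\<close> and \<open>1\<close>, so its orbit determines the cube; as independent cycles are disjoint, the cube
  also has \<open>2\<^sup>k\<close> distinct vertices and the orbit determines the coordinates up to the choice of the
  base vertex.  Hence the open cubes are embedded and decompose the space, and the dimer complex meets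
  every cube of the ambient complex in a finite union of faces, which makes its subspace topology the
  weak one (\<open>cubed_complex_dimer_complex\<close>).

  Near a vertex \<open>A\<close> all coordinates with respect to \<open>A\<close> are small, so no flip can relate two points
  there, and a direction at \<open>A\<close> is the same as its velocity function extended by zero
  (\<open>ray_germ_eq_iff\<close>).  So a cube \<open>(A, S)\<close> gives an embedded simplex with vertex set \<open>S\<close>, and the
  simplices of \<open>S\<close> and \<open>R\<close> meet in the common face with vertex set \<open>S \<inter> R\<close>
  (\<open>link_simplicial_dimer_complex\<close>).

  For the flag property, pairwise adjacent vertices of the link are given by pairwise independent
  even cycles.  All vertices of the cube \<open>(A, S)\<close> that they
  span are dimer coverings: being a dimer covering is tested at one vertex of the graph at a time,
  and there at most one of the cycles changes anything (\<open>dimer_cube_of_edges\<close>).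
\<close>

section \<open>Products of sets of cycles in the power group\<close>

text \<open>The product of \<open>T\<close> in the power group, i.e. its sum in the vector space \<open>2\<^sup>E\<close> over the field with two
elements.  Membership is decided by the parity of a number of elements, so the formula makes sense
for every finite family of sets; symmetric differences of sets of cycles can be formed without
having to know that the result is a set of independent cycles.\<close>

definition parity_sum :: "'e set set \<Rightarrow> 'e set" where
  "parity_sum T = {e. odd (card {t \<in> T. e \<in> t})}"

definition shift :: "'e set set \<Rightarrow> 'e set \<Rightarrow> 'e set" where
  "shift T A = sym_diff (parity_sum T) A"

lemma parity_sum_empty [simp]: "parity_sum {} = {}"
  by (simp add: parity_sum_def)

lemma parity_sum_singleton [simp]: "parity_sum {s} = s"
proof -
  have "{t \<in> {s}. e \<in> t} = (if e \<in> s then {s} else {})" for e by auto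
  then show ?thesis by (auto simp: parity_sum_def)
qed

lemma odd_card_sym_diff:
  assumes "finite P" "finite Q"
  shows "odd (card (sym_diff P Q)) \<longleftrightarrow> odd (card P) \<noteq> odd (card Q)"
proof -
  have "card (sym_diff P Q) = card (P - Q) + card (Q - P)"
    using assms by (intro card_Un_disjoint) auto
  moreover have "card P = card (P - Q) + card (P \<inter> Q)"
    using assms by (metis add.commute card_Int_Diff)
  moreover have "card Q = card (Q - P) + card (P \<inter> Q)"
    using assms by (metis add.commute card_Int_Diff inf_commute)
  ultimately show ?thesis by auto
qed

text \<open>Parity of cardinality is additive under symmetric difference.  Hence \<open>shift\<close> is an action of the
group of finite sets of sets, under symmetric difference, on the power group.\<close>

lemma parity_sum_sym_diff:
  assumes "finite T" "finite T'"
  shows "parity_sum (sym_diff T T') = sym_diff (parity_sum T) (parity_sum T')"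
proof -
  have "odd (card {t \<in> sym_diff T T'. e \<in> t})
      \<longleftrightarrow> odd (card {t \<in> T. e \<in> t}) \<noteq> odd (card {t \<in> T'. e \<in> t})" for e
  proof -
    have "{t \<in> sym_diff T T'. e \<in> t} = sym_diff {t \<in> T. e \<in> t} {t \<in> T'. e \<in> t}" by auto
    then show ?thesis using odd_card_sym_diff[of "{t \<in> T. e \<in> t}" "{t \<in> T'. e \<in> t}"] assms by simp
  qed
  then show ?thesis unfolding parity_sum_def by auto
qed

lemma shift_empty [simp]: "shift {} A = A"
  by (simp add: shift_def)

lemma shift_shift:
  assumes "finite T" "finite T'"
  shows "shift T (shift T' A) = shift (sym_diff T T') A"
  unfolding shift_def parity_sum_sym_diff[OF assms] by auto

lemma shift_shift_same [simp]: "shift T (shift T A) = A"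
  unfolding shift_def by auto

lemma parity_sum_subset: "T \<subseteq> Pow E \<Longrightarrow> parity_sum T \<subseteq> E"
  unfolding parity_sum_def
  by (metis (no_types, lifting) Collect_empty_eq Pow_iff card.empty mem_Collect_eq odd_card_imp_not_empty subset_eq)

lemma comm_group_power_group: "comm_group (power_group E)"
proof (rule comm_groupI)
  fix A assume "A \<in> carrier (power_group E)"
  then show "\<exists>B\<in>carrier (power_group E). B \<otimes>\<^bsub>power_group E\<^esub> A = \<one>\<^bsub>power_group E\<^esub>"
    by (intro bexI[of _ A]) (auto simp: power_group_def)
qed (auto simp: power_group_def)

lemma finprod_power_group:
  assumes "finite T" "T \<subseteq> Pow E"
  shows "finprod (power_group E) (\<lambda>s. s) T = parity_sum T"
  using assms
proof (induction T rule: finite_induct)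
  case empty
  interpret comm_group "power_group E" by (rule comm_group_power_group)
  have "finprod (power_group E) (\<lambda>s. s) {} = \<one>\<^bsub>power_group E\<^esub>" by (rule finprod_empty)
  then show ?case by (simp add: power_group_def)
next
  case (insert s T)
  interpret comm_group "power_group E" by (rule comm_group_power_group)
  have "finprod (power_group E) (\<lambda>s. s) (insert s T)
      = s \<otimes>\<^bsub>power_group E\<^esub> finprod (power_group E) (\<lambda>s. s) T"
    using insert by (intro finprod_insert) (auto simp: power_group_def)
  also have "\<dots> = sym_diff (parity_sum {s}) (parity_sum T)"
    using insert by (auto simp: power_group_def)
  also have "\<dots> = parity_sum (sym_diff {s} T)"
    using insert by (intro parity_sum_sym_diff[symmetric]) auto
  also have "sym_diff {s} T = insert s T" using insert by auto
  finally show ?case .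
qed

lemma glide_eq_shift:
  assumes "finite T" "T \<subseteq> Pow (edges \<Gamma>)"
  shows "glide \<Gamma> T A = shift T A"
  unfolding glide_def finprod_power_group[OF assms] by (auto simp: power_group_def shift_def)

section \<open>Based cubes\<close>

lemma even_cycle_nonempty: "even_cycle \<Gamma> s \<Longrightarrow> s \<noteq> {}"
  unfolding even_cycle_def forms_circle_def bij_betw_def by (auto simp: lessThan_empty_iff)

lemma based_cubesD:
  assumes "(A, S) \<in> based_cubes \<Gamma>"
  shows "A \<subseteq> edges \<Gamma>" "finite S" "S \<subseteq> Pow (edges \<Gamma>)" "\<And>s. s \<in> S \<Longrightarrow> even_cycle \<Gamma> s"
    "pairwise (independent_edge_sets \<Gamma>) S"
  using assms
  by (auto simp: based_cubes_def power_group_def even_cycle_def cyclic_set_def)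

lemma based_cubes_subset: "(A, S) \<in> based_cubes \<Gamma> \<Longrightarrow> R \<subseteq> S \<Longrightarrow> (A, R) \<in> based_cubes \<Gamma>"
  unfolding based_cubes_def by (auto intro: finite_subset pairwise_subset)

lemma based_cubes_shift:
  assumes "(A, S) \<in> based_cubes \<Gamma>" "T \<subseteq> S"
  shows "(shift T A, S) \<in> based_cubes \<Gamma>"
  using assms parity_sum_subset[of T "edges \<Gamma>"] based_cubesD[OF assms(1)]
  by (auto simp: based_cubes_def power_group_def shift_def)

lemma based_cubes_glide:
  assumes "(A, S) \<in> based_cubes \<Gamma>" "T \<subseteq> S"
  shows "glide \<Gamma> T B = shift T B"
  using assms based_cubesD[OF assms(1)] by (intro glide_eq_shift) (auto intro: finite_subset)

lemma independent_cycles_disjoint: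
  assumes "is_graph \<Gamma>" "(A, S) \<in> based_cubes \<Gamma>" "s \<in> S" "t \<in> S" "e \<in> s" "e \<in> t"
  shows "s = t"
proof (rule ccontr)
  assume "s \<noteq> t"
  then have "independent_edge_sets \<Gamma> s t"
    using based_cubesD(5)[OF assms(2)] assms(3,4) by (simp add: pairwise_def)
  then have "ends \<Gamma> e = {}"
    using assms(5,6) by (auto simp: independent_edge_sets_def)
  moreover have "card (ends \<Gamma> e) = 2"
    using assms based_cubesD(3)[OF assms(2)] by (auto simp: is_graph_def)
  ultimately show False by simp
qed

text \<open>Independent cycles share no vertex, hence no edge, as every edge has an end: each edge is counted at
most once.\<close>

lemma parity_sum_eq_Union:
  assumes "is_graph \<Gamma>" "(A, S) \<in> based_cubes \<Gamma>" "T \<subseteq> S"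
  shows "parity_sum T = \<Union>T"
proof -
  have "{t \<in> T. e \<in> t} = {s}" if "s \<in> T" "e \<in> s" for s e
    using that independent_cycles_disjoint[OF assms(1,2)] assms(3) by blast
  then have "\<Union>T \<subseteq> parity_sum T"
    unfolding parity_sum_def by fastforce
  moreover have "parity_sum T \<subseteq> \<Union>T"
    unfolding parity_sum_def using odd_card_imp_not_empty by fastforce
  ultimately show ?thesis by (rule subset_antisym[rotated])
qed

text \<open>A cube has \<open>2\<^sup>k\<close> distinct vertices: independent cycles are disjoint and nonempty, so no nonempty set
of them has trivial product.\<close>

lemma shift_eq_self_imp_empty:
  assumes "is_graph \<Gamma>" "(A, S) \<in> based_cubes \<Gamma>" "T \<subseteq> S" "shift T B = B"
  shows "T = {}"
proof -
  have "parity_sum T = {}" using assms(4) by (auto simp: shift_def)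
  then have "\<Union>T = {}" using parity_sum_eq_Union[OF assms(1-3)] by simp
  then show ?thesis
    using even_cycle_nonempty based_cubesD(4)[OF assms(2)] assms(3) by blast
qed

section \<open>When two points are glued\<close>

definition zero_extend :: "'i set \<Rightarrow> ('i \<Rightarrow> real) \<Rightarrow> 'i \<Rightarrow> real" where
  "zero_extend S x s = (if s \<in> S then x s else 0)"

text \<open>The partner of \<open>shift\<close> on coordinates: rebasing a cube by \<open>T\<close> moves the base vertex by \<open>shift T\<close> and
reflects the coordinates in \<open>T\<close>.\<close>

definition flip :: "'i set \<Rightarrow> ('i \<Rightarrow> real) \<Rightarrow> 'i \<Rightarrow> real" where
  "flip T x s = (if s \<in> T then 1 - x s else x s)"

text \<open>A based point is turned into an element of the power group together with a function on all sets of
edges, by putting the coordinates in absent directions to \<open>0\<close>.  Gluing along a face does not change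
this pair, and rebasing lets a finite set \<open>T\<close> act on it by \<open>shift T\<close> and \<open>flip T\<close>; so glued points
lie in one orbit of a group action.  The set \<open>T\<close> automatically consists of directions of
the two cubes: a coordinate absent on one side counts as \<open>0\<close>, so the flip makes it \<open>1\<close> on the other.\<close>

fun same_orbit :: "'e based_point \<Rightarrow> 'e based_point \<Rightarrow> bool" where
  "same_orbit (A, S, x) (B, R, y) \<longleftrightarrow>
     (\<exists>T. finite T \<and> B = shift T A \<and> zero_extend R y = flip T (zero_extend S x))"

lemma flip_flip: "flip T (flip T' x) = flip (sym_diff T T') x"
  by (auto simp: flip_def fun_eq_iff)

lemma flip_empty [simp]: "flip {} x = x"
  by (auto simp: flip_def fun_eq_iff)

lemma same_orbit_refl: "same_orbit r r"
  by (cases r) (auto intro!: exI[of _ "{}"])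

lemma same_orbit_sym: "same_orbit r r' \<Longrightarrow> same_orbit r' r"
proof (cases r; cases r')
  fix A S x B R y
  assume "same_orbit r r'" and r: "r = (A, S, x)" "r' = (B, R, y)"
  then obtain T where "finite T" "B = shift T A" "zero_extend R y = flip T (zero_extend S x)"
    by auto
  then show "same_orbit r' r" using r by (auto simp: flip_flip intro!: exI[of _ T])
qed

lemma same_orbit_trans:
  assumes "same_orbit r r'" "same_orbit r' r''"
  shows "same_orbit r r''"
proof -
  obtain A S x B R y C Q z where r: "r = (A, S, x)" "r' = (B, R, y)" "r'' = (C, Q, z)"
    by (metis prod_cases3)
  then obtain T T' where "finite T" "B = shift T A" "zero_extend R y = flip T (zero_extend S x)"
    "finite T'" "C = shift T' B" "zero_extend Q z = flip T' (zero_extend R y)"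
    using assms by auto
  then show ?thesis using r
    by (auto simp: flip_flip shift_shift intro!: exI[of _ "sym_diff T' T"])
qed

lemma flip_in_cube: "x \<in> cube S \<Longrightarrow> R \<subseteq> S \<Longrightarrow> restrict (flip T x) R \<in> cube R"
  by (fastforce simp: cube_def flip_def PiE_iff)

lemma restrict_in_cube: "x \<in> cube S \<Longrightarrow> R \<subseteq> S \<Longrightarrow> restrict x R \<in> cube R"
  by (fastforce simp: cube_def PiE_iff)

lemma glue_imp_same_orbit: "glue \<Gamma> r r' \<Longrightarrow> same_orbit r r'"
proof (induction rule: glue.induct)
  case (face A S' S x' x)
  then show ?case
    by (auto simp: zero_extend_def fun_eq_iff intro!: exI[of _ "{}"])
next
  case (rebase A S T x x')
  have "finite T" using rebase based_cubesD(2) finite_subset by metis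
  then show ?case using rebase
    by (auto simp: based_cubes_glide zero_extend_def flip_def fun_eq_iff intro!: exI[of _ T])
qed

lemma equivclp_glue_imp_same_orbit: "equivclp (glue \<Gamma>) r r' \<Longrightarrow> same_orbit r r'"
  by (induction rule: equivclp_induct)
     (auto intro: same_orbit_refl same_orbit_trans same_orbit_sym dest: glue_imp_same_orbit)

lemma glued_point_eq_iff_equivclp:
  "glued_point \<Gamma> r = glued_point \<Gamma> r' \<longleftrightarrow> equivclp (glue \<Gamma>) r r'"
  unfolding glued_point_def
  by (auto intro: equivclp_sym equivclp_trans)

lemma glue_imp_glued_point_eq: "glue \<Gamma> r r' \<Longrightarrow> glued_point \<Gamma> r = glued_point \<Gamma> r'"
  unfolding glued_point_eq_iff_equivclp by (rule r_into_equivclp)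

lemma glued_point_rebase:
  assumes "(A, S) \<in> based_cubes \<Gamma>" "x \<in> cube S" "T \<subseteq> S"
  shows "glued_point \<Gamma> (A, S, x) = glued_point \<Gamma> (shift T A, S, restrict (flip T x) S)"
proof -
  have "glue \<Gamma> (A, S, x) (glide \<Gamma> T A, S, restrict (flip T x) S)"
    using assms by (intro glue.rebase flip_in_cube) (auto simp: flip_def)
  then show ?thesis
    using glue_imp_glued_point_eq based_cubes_glide[OF assms(1,3)] by metis
qed

text \<open>Rebasing by the coordinates equal to \<open>1\<close> makes them \<open>0\<close>, and then they can be dropped.  Thus every
point of a cube is an interior point of a face of it.\<close>

lemma glued_point_open_face:
  assumes "(A, S) \<in> based_cubes \<Gamma>" "x \<in> cube S"
  defines "T \<equiv> {s \<in> S. x s = 1}" and "R \<equiv> {s \<in> S. 0 < x s \<and> x s < 1}"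
  shows "glued_point \<Gamma> (A, S, x) = glued_point \<Gamma> (shift T A, R, restrict x R)"
    "restrict x R \<in> open_cube R"
proof -
  let ?y = "restrict (flip T x) S"
  have TS: "T \<subseteq> S" unfolding T_def by auto
  have "glue \<Gamma> (shift T A, R, restrict x R) (shift T A, S, ?y)"
  proof (rule glue.face)
    show "(shift T A, S) \<in> based_cubes \<Gamma>" by (rule based_cubes_shift[OF assms(1) TS])
    show "?y \<in> cube S" using assms(2) by (rule flip_in_cube) simp
    show "R \<subseteq> S" "restrict x R = restrict ?y R"
      unfolding R_def T_def flip_def by (auto simp: restrict_def)
    show "?y s = 0" if "s \<in> S - R" for s
    proof -
      have "0 \<le> x s" "x s \<le> 1" using that assms(2) by (auto simp: cube_def)
      then show ?thesis using that by (auto simp: R_def T_def flip_def)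
    qed
  qed
  then show "glued_point \<Gamma> (A, S, x) = glued_point \<Gamma> (shift T A, R, restrict x R)"
    using glue_imp_glued_point_eq glued_point_rebase[OF assms(1,2) TS] by metis
  show "restrict x R \<in> open_cube R"
    unfolding R_def open_cube_def by auto
qed

lemma open_cube_subset_cube: "open_cube S \<subseteq> cube S"
  unfolding open_cube_def cube_def by (intro PiE_mono) auto

text \<open>A coordinate strictly between \<open>0\<close> and \<open>1\<close> stays so under a flip, and an absent coordinate counts as
\<open>0\<close>, which a flip would make \<open>1\<close>.  So interior points of two cubes are in one orbit only if the cubes
have the same directions, and only flips of such directions are involved.\<close>

lemma same_orbit_open_cubes:
  assumes "same_orbit (A, S, x) (B, R, y)" "x \<in> open_cube S" "y \<in> open_cube R"
  obtains T where "R = S" "T \<subseteq> S" "B = shift T A" "y = restrict (flip T x) S"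
proof -
  obtain T where T: "B = shift T A" "zero_extend R y = flip T (zero_extend S x)"
    using assms by auto
  have x: "s \<in> S \<Longrightarrow> 0 < x s \<and> x s < 1" and y: "s \<in> R \<Longrightarrow> 0 < y s \<and> y s < 1" for s
    using assms by (auto simp: open_cube_def)
  have eq: "(if s \<in> R then y s else 0) = (if s \<in> T then 1 - (if s \<in> S then x s else 0)
      else if s \<in> S then x s else 0)" for s
    using fun_cong[OF T(2), of s] by (simp add: zero_extend_def flip_def)
  have *: "(s \<in> R \<longleftrightarrow> s \<in> S) \<and> (s \<in> T \<longrightarrow> s \<in> S)" for s
    using eq[of s] x[of s] y[of s] by (auto split: if_splits)
  then have "R = S" "T \<subseteq> S" by auto
  moreover have "y = restrict (flip T x) S"
  proof
    fix s show "y s = restrict (flip T x) S s"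
      using eq[of s] * assms(3) PiE_arb[of y R _ s] unfolding open_cube_def
      by (auto simp: flip_def split: if_splits)
  qed
  ultimately show ?thesis using that T by blast
qed

text \<open>The equivalence relation generated by the gluing is the orbit relation.  It suffices to compare the
interior points of faces that represent the two given points, and these are in one orbit only if a
single rebasing relates them.\<close>

lemma glued_point_eq_iff:
  assumes "(A, S) \<in> based_cubes \<Gamma>" "x \<in> cube S" "(B, R) \<in> based_cubes \<Gamma>" "y \<in> cube R"
  shows "glued_point \<Gamma> (A, S, x) = glued_point \<Gamma> (B, R, y) \<longleftrightarrow> same_orbit (A, S, x) (B, R, y)"
proof
  assume "glued_point \<Gamma> (A, S, x) = glued_point \<Gamma> (B, R, y)"
  then show "same_orbit (A, S, x) (B, R, y)"
    unfolding glued_point_eq_iff_equivclp by (rule equivclp_glue_imp_same_orbit)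
next
  assume orbit: "same_orbit (A, S, x) (B, R, y)"
  let ?T = "{s \<in> S. x s = 1}" and ?S' = "{s \<in> S. 0 < x s \<and> x s < 1}"
  let ?T' = "{s \<in> R. y s = 1}" and ?R' = "{s \<in> R. 0 < y s \<and> y s < 1}"
  note x' = glued_point_open_face[OF assms(1,2)] and y' = glued_point_open_face[OF assms(3,4)]
  have "same_orbit (A, S, x) (shift ?T A, ?S', restrict x ?S')"
    using x'(1) unfolding glued_point_eq_iff_equivclp by (rule equivclp_glue_imp_same_orbit)
  moreover have "same_orbit (B, R, y) (shift ?T' B, ?R', restrict y ?R')"
    using y'(1) unfolding glued_point_eq_iff_equivclp by (rule equivclp_glue_imp_same_orbit)
  ultimately have "same_orbit (shift ?T A, ?S', restrict x ?S') (shift ?T' B, ?R', restrict y ?R')"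
    using orbit by (blast intro: same_orbit_trans same_orbit_sym)
  then obtain T where T: "?R' = ?S'" "T \<subseteq> ?S'" "shift ?T' B = shift T (shift ?T A)"
    "restrict y ?R' = restrict (flip T (restrict x ?S')) ?S'"
    using x'(2) y'(2) by (rule same_orbit_open_cubes)
  have "(shift ?T A, ?S') \<in> based_cubes \<Gamma>"
    by (rule based_cubes_subset[OF based_cubes_shift[OF assms(1)]]) auto
  then have "glued_point \<Gamma> (shift ?T A, ?S', restrict x ?S')
      = glued_point \<Gamma> (shift T (shift ?T A), ?S', restrict (flip T (restrict x ?S')) ?S')"
    using x'(2) open_cube_subset_cube T(2) by (intro glued_point_rebase) auto
  then show "glued_point \<Gamma> (A, S, x) = glued_point \<Gamma> (B, R, y)"
    using x'(1) y'(1) T by metis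
qed

lemma glued_point_eqI:
  assumes "(A, S) \<in> based_cubes \<Gamma>" "x \<in> cube S" "(B, R) \<in> based_cubes \<Gamma>" "y \<in> cube R"
    and "finite T" "B = shift T A" "\<And>s. zero_extend R y s = flip T (zero_extend S x) s"
  shows "glued_point \<Gamma> (A, S, x) = glued_point \<Gamma> (B, R, y)"
  unfolding glued_point_eq_iff[OF assms(1-4)] using assms(5-) by (auto simp: fun_eq_iff)

lemma glued_point_open_cubes:
  assumes "(A, S) \<in> based_cubes \<Gamma>" "x \<in> open_cube S" "(B, R) \<in> based_cubes \<Gamma>" "y \<in> open_cube R"
    and "glued_point \<Gamma> (A, S, x) = glued_point \<Gamma> (B, R, y)"
  obtains T where "R = S" "T \<subseteq> S" "B = shift T A" "y = restrict (flip T x) S"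
proof -
  have "same_orbit (A, S, x) (B, R, y)"
    using assms glued_point_eq_iff[of A S \<Gamma> x B R y] open_cube_subset_cube by blast
  then show ?thesis using assms(2,4) that by (rule same_orbit_open_cubes)
qed

text \<open>The general form of the passage to a face, in which the set of coordinates equal to \<open>1\<close> is \<open>T\<close>.  The
additional rebasing by \<open>T'\<close> serves to reach the based cube chosen to represent the cell of the
face.\<close>

lemma glued_point_face:
  assumes "(A, S) \<in> based_cubes \<Gamma>" "x \<in> cube S" "R \<subseteq> S" "T \<subseteq> S - R" "T' \<subseteq> R"
    and "\<And>s. s \<in> S - R \<Longrightarrow> x s = (if s \<in> T then 1 else 0)"
  shows "glued_point \<Gamma> (A, S, x)
    = glued_point \<Gamma> (shift T' (shift T A), R, restrict (flip T' x) R)"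
proof -
  have fin: "finite T" "finite T'"
    using assms based_cubesD(2)[OF assms(1)] by (meson Diff_subset finite_subset)+
  have "(shift T' (shift T A), R) \<in> based_cubes \<Gamma>"
    using assms based_cubes_shift based_cubes_subset
    by (metis Diff_subset subset_trans)
  then show ?thesis
    using assms fin
    by (intro glued_point_eqI[where T = "sym_diff T' T"] flip_in_cube)
       (auto simp: shift_shift zero_extend_def flip_def)
qed

section \<open>The cells of the dimer complex\<close>

definition cube_of :: "('v, 'e) multigraph \<Rightarrow> 'e set \<Rightarrow> 'e set set \<Rightarrow> 'e based_cube set" where
  "cube_of \<Gamma> A S = based_cube_rel \<Gamma> `` {(A, S)}"

text \<open>The based cubes that represent the cells of the dimer complex, cf. \<open>cells_dimer_complex\<close>.\<close>

definition dimer_cubes :: "('v, 'e) multigraph \<Rightarrow> 'e based_cube set" where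
  "dimer_cubes \<Gamma> = {(A, S) \<in> based_cubes \<Gamma>. \<forall>T\<subseteq>S. shift T A \<in> dimer_coverings \<Gamma>}"

lemma cube_of_eq:
  assumes "(A, S) \<in> based_cubes \<Gamma>"
  shows "cube_of \<Gamma> A S = {(shift T A, S) |T. T \<subseteq> S}"
proof -
  have "cube_of \<Gamma> A S = {(glide \<Gamma> T A, S) |T. T \<subseteq> S}"
    unfolding cube_of_def based_cube_rel_def using assms by auto
  also have "\<dots> = {(shift T A, S) |T. T \<subseteq> S}"
    using based_cubes_glide[OF assms] by (metis (no_types, lifting))
  finally show ?thesis .
qed

lemma subset_cube_shift:
  assumes "finite S" "T \<subseteq> S" "T' \<subseteq> S"
  shows "shift T' (shift T A) = shift (sym_diff T' T) A" "sym_diff T' T \<subseteq> S"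
proof -
  have "finite T'" "finite T" using assms finite_subset by auto
  then show "shift T' (shift T A) = shift (sym_diff T' T) A" by (rule shift_shift)
  show "sym_diff T' T \<subseteq> S" using assms by auto
qed

lemma cube_of_shift:
  assumes "(A, S) \<in> based_cubes \<Gamma>" "T \<subseteq> S"
  shows "cube_of \<Gamma> (shift T A) S = cube_of \<Gamma> A S"
proof -
  note fin = based_cubesD(2)[OF assms(1)]
  have *: "{(shift U (shift T B), S) |U. U \<subseteq> S} \<subseteq> {(shift U B, S) |U. U \<subseteq> S}" for B
    using subset_cube_shift[OF fin assms(2)] by blast
  have "{(shift U A, S) |U. U \<subseteq> S} \<subseteq> {(shift U (shift T A), S) |U. U \<subseteq> S}"
    using *[of "shift T A"] by simp
  then show ?thesis
    using *[of A] unfolding cube_of_eq[OF assms(1)] cube_of_eq[OF based_cubes_shift[OF assms]]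
    by (rule subset_antisym[rotated])
qed

lemma representative_cube_of:
  assumes "(A, S) \<in> based_cubes \<Gamma>"
  obtains T where "T \<subseteq> S" "representative (cube_of \<Gamma> A S) = (shift T A, S)"
proof -
  have "(shift {} A, S) \<in> cube_of \<Gamma> A S" unfolding cube_of_eq[OF assms] by blast
  then have "representative (cube_of \<Gamma> A S) \<in> cube_of \<Gamma> A S"
    unfolding representative_def by (rule someI)
  then show ?thesis using that unfolding cube_of_eq[OF assms] by blast
qed

text \<open>All representatives of a cube have the same vertices, so the condition on the cells of the dimer
complex can be tested on any one of them.\<close>

lemma cube_vertices_cube_of:
  assumes "(A, S) \<in> based_cubes \<Gamma>"
  shows "cube_vertices \<Gamma> (cube_of \<Gamma> A S) = {shift T A |T. T \<subseteq> S}"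
proof -
  note fin = based_cubesD(2)[OF assms]
  have "cube_vertices \<Gamma> (cube_of \<Gamma> A S) = {shift T (shift U A) |T U. T \<subseteq> S \<and> U \<subseteq> S}"
  proof -
    have "cube_vertices \<Gamma> (cube_of \<Gamma> A S) = {glide \<Gamma> T (shift U A) |T U. T \<subseteq> S \<and> U \<subseteq> S}"
      unfolding cube_vertices_def cube_of_eq[OF assms] by auto
    also have "\<dots> = {shift T (shift U A) |T U. T \<subseteq> S \<and> U \<subseteq> S}"
      using based_cubes_glide[OF assms] by (metis (no_types, lifting))
    finally show ?thesis .
  qed
  also have "\<dots> = {shift T A |T. T \<subseteq> S}"
  proof (intro equalityI subsetI)
    fix B assume "B \<in> {shift T (shift U A) |T U. T \<subseteq> S \<and> U \<subseteq> S}"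
    then obtain T U where TU: "T \<subseteq> S" "U \<subseteq> S" and B: "B = shift T (shift U A)" by auto
    show "B \<in> {shift T A |T. T \<subseteq> S}"
      unfolding B subset_cube_shift(1)[OF fin TU(2,1)]
      using subset_cube_shift(2)[OF fin TU(2,1)] by blast
  next
    fix B assume "B \<in> {shift T A |T. T \<subseteq> S}"
    then obtain T where "T \<subseteq> S" "B = shift T (shift {} A)" by auto
    then show "B \<in> {shift T (shift U A) |T U. T \<subseteq> S \<and> U \<subseteq> S}" by blast
  qed
  finally show ?thesis .
qed

lemma group_cubes_eq: "group_cubes \<Gamma> = (\<lambda>(A, S). cube_of \<Gamma> A S) ` based_cubes \<Gamma>"
  unfolding group_cubes_def quotient_def cube_of_def by auto

lemma cells_dimer_complex:
  "cells (dimer_complex \<Gamma>) = (\<lambda>(A, S). cube_of \<Gamma> A S) ` dimer_cubes \<Gamma>"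
proof -
  have "cells (dimer_complex \<Gamma>)
      = {Q \<in> group_cubes \<Gamma>. cube_vertices \<Gamma> Q \<subseteq> dimer_coverings \<Gamma>}"
    by (simp add: dimer_complex_def subcomplex_def)
  also have "\<dots> = (\<lambda>(A, S). cube_of \<Gamma> A S) ` dimer_cubes \<Gamma>"
    unfolding group_cubes_eq dimer_cubes_def
    by (auto simp: cube_vertices_cube_of image_iff) blast+
  finally show ?thesis .
qed

lemma dimer_cubes_imp_based: "(A, S) \<in> dimer_cubes \<Gamma> \<Longrightarrow> (A, S) \<in> based_cubes \<Gamma>"
  by (simp add: dimer_cubes_def)

lemma dimer_cubes_face:
  assumes "(A, S) \<in> dimer_cubes \<Gamma>" "T \<subseteq> S" "R \<subseteq> S"
  shows "(shift T A, R) \<in> dimer_cubes \<Gamma>"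
proof -
  have bc: "(A, S) \<in> based_cubes \<Gamma>" using assms by (simp add: dimer_cubes_def)
  have "shift U (shift T A) \<in> dimer_coverings \<Gamma>" if "U \<subseteq> R" for U
  proof -
    have U: "U \<subseteq> S" using that assms(3) by blast
    show ?thesis
      using subset_cube_shift[OF based_cubesD(2)[OF bc] assms(2) U] assms(1)
      by (simp add: dimer_cubes_def)
  qed
  then show ?thesis
    using based_cubes_subset[OF based_cubes_shift[OF bc assms(2)] assms(3)]
    by (simp add: dimer_cubes_def)
qed

text \<open>Two complementary ways to see a cell.  Starting from a cell one may take the representative that
defines its map; starting from a based cube, the map of its cell is based at some vertex
\<open>shift T A\<close>, over which there is no control.\<close>

lemma dimer_cell_cases:
  assumes "Q \<in> cells (dimer_complex \<Gamma>)"
  obtains A S where "(A, S) \<in> dimer_cubes \<Gamma>" "Q = cube_of \<Gamma> A S"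
    "coords (dimer_complex \<Gamma>) Q = S"
    "char_map (dimer_complex \<Gamma>) Q = (\<lambda>x. glued_point \<Gamma> (A, S, x))"
proof -
  obtain A S where AS: "(A, S) \<in> dimer_cubes \<Gamma>" "Q = cube_of \<Gamma> A S"
    using assms unfolding cells_dimer_complex by auto
  note bc = dimer_cubes_imp_based[OF AS(1)]
  obtain T where T: "T \<subseteq> S" "representative Q = (shift T A, S)"
    unfolding AS(2) by (rule representative_cube_of[OF bc])
  have "(shift T A, S) \<in> dimer_cubes \<Gamma>" using dimer_cubes_face[OF AS(1) T(1)] by simp
  then show ?thesis using that[of "shift T A" S] AS(2) T cube_of_shift[OF bc T(1)]
    by (simp add: dimer_complex_def subcomplex_def group_complex_def)
qed

lemma dimer_cell_of_cube:
  assumes "(A, S) \<in> dimer_cubes \<Gamma>"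
  obtains T where "T \<subseteq> S" "cube_of \<Gamma> A S \<in> cells (dimer_complex \<Gamma>)"
    "coords (dimer_complex \<Gamma>) (cube_of \<Gamma> A S) = S"
    "char_map (dimer_complex \<Gamma>) (cube_of \<Gamma> A S) = (\<lambda>x. glued_point \<Gamma> (shift T A, S, x))"
proof -
  obtain T where T: "T \<subseteq> S" "representative (cube_of \<Gamma> A S) = (shift T A, S)"
    by (rule representative_cube_of[OF dimer_cubes_imp_based[OF assms]])
  moreover have "cube_of \<Gamma> A S \<in> cells (dimer_complex \<Gamma>)"
    unfolding cells_dimer_complex using assms by (intro image_eqI[of _ _ "(A, S)"]) auto
  ultimately show ?thesis using that[of T]
    by (simp add: dimer_complex_def subcomplex_def group_complex_def)
qed

section \<open>The decomposition into open cubes\<close>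

lemma dimer_cell_inj_on_open_cube:
  assumes "is_graph \<Gamma>" "Q \<in> cells (dimer_complex \<Gamma>)"
  defines "X \<equiv> dimer_complex \<Gamma>"
  shows "inj_on (char_map X Q) (open_cube (coords X Q))"
proof -
  obtain A S where Q: "(A, S) \<in> dimer_cubes \<Gamma>" "coords X Q = S"
    "char_map X Q = (\<lambda>x. glued_point \<Gamma> (A, S, x))"
    using assms(2) unfolding X_def by (rule dimer_cell_cases)
  note bc = dimer_cubes_imp_based[OF Q(1)]
  show ?thesis unfolding Q
  proof (rule inj_onI)
    fix x y assume xy: "x \<in> open_cube S" "y \<in> open_cube S"
      "glued_point \<Gamma> (A, S, x) = glued_point \<Gamma> (A, S, y)"
    from bc xy(1) bc xy(2,3) obtain T where T: "T \<subseteq> S" "A = shift T A" "y = restrict (flip T x) S"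
      by (rule glued_point_open_cubes)
    have "T = {}" by (rule shift_eq_self_imp_empty[OF assms(1) bc T(1) T(2)[symmetric]])
    then show "x = y" using T(3) xy(1) by (simp add: open_cube_def PiE_restrict)
  qed
qed

lemma dimer_open_cells_disjoint:
  assumes "Q \<in> cells (dimer_complex \<Gamma>)" "Q' \<in> cells (dimer_complex \<Gamma>)" "Q \<noteq> Q'"
  defines "X \<equiv> dimer_complex \<Gamma>"
  shows "char_map X Q ` open_cube (coords X Q) \<inter> char_map X Q' ` open_cube (coords X Q') = {}"
proof -
  obtain A S where Q: "(A, S) \<in> dimer_cubes \<Gamma>" "Q = cube_of \<Gamma> A S" "coords X Q = S"
    "char_map X Q = (\<lambda>x. glued_point \<Gamma> (A, S, x))"
    using assms(1) unfolding X_def by (rule dimer_cell_cases)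
  obtain B R where Q': "(B, R) \<in> dimer_cubes \<Gamma>" "Q' = cube_of \<Gamma> B R" "coords X Q' = R"
    "char_map X Q' = (\<lambda>x. glued_point \<Gamma> (B, R, x))"
    using assms(2) unfolding X_def by (rule dimer_cell_cases)
  note bc = dimer_cubes_imp_based[OF Q(1)] dimer_cubes_imp_based[OF Q'(1)]
  have False if xy: "x \<in> open_cube S" "y \<in> open_cube R"
    "glued_point \<Gamma> (A, S, x) = glued_point \<Gamma> (B, R, y)" for x y
  proof -
    obtain T where "R = S" "T \<subseteq> S" "B = shift T A"
      using bc(1) xy(1) bc(2) xy(2,3) by (rule glued_point_open_cubes)
    then show False using cube_of_shift[OF bc(1)] assms(3) Q(2) Q'(2) by simp
  qed
  then show ?thesis unfolding Q(3,4) Q'(3,4) by blast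
qed

definition dimer_points :: "('v, 'e) multigraph \<Rightarrow> 'e based_point set set" where
  "dimer_points \<Gamma> = {glued_point \<Gamma> (A, S, x) |A S x. (A, S) \<in> dimer_cubes \<Gamma> \<and> x \<in> cube S}"

lemma dimer_points_subset_group_points: "dimer_points \<Gamma> \<subseteq> group_points \<Gamma>"
  unfolding dimer_points_def group_points_def using dimer_cubes_imp_based by blast

lemma glued_point_in_open_dimer_cell:
  assumes "(A, S) \<in> dimer_cubes \<Gamma>" "x \<in> open_cube S"
  defines "X \<equiv> dimer_complex \<Gamma>"
  shows "glued_point \<Gamma> (A, S, x) \<in> (\<Union>Q\<in>cells X. char_map X Q ` open_cube (coords X Q))"
proof -
  obtain T where Q: "T \<subseteq> S" "cube_of \<Gamma> A S \<in> cells X" "coords X (cube_of \<Gamma> A S) = S"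
    "char_map X (cube_of \<Gamma> A S) = (\<lambda>x. glued_point \<Gamma> (shift T A, S, x))"
    unfolding X_def by (rule dimer_cell_of_cube[OF assms(1)])
  have "restrict (flip T x) S \<in> open_cube S"
    using assms(2) by (auto simp: open_cube_def flip_def PiE_iff)
  moreover have "glued_point \<Gamma> (A, S, x) = glued_point \<Gamma> (shift T A, S, restrict (flip T x) S)"
    using assms Q(1) open_cube_subset_cube
    by (intro glued_point_rebase dimer_cubes_imp_based) auto
  ultimately have "glued_point \<Gamma> (A, S, x)
      \<in> char_map X (cube_of \<Gamma> A S) ` open_cube (coords X (cube_of \<Gamma> A S))"
    unfolding Q(3,4) by (intro image_eqI[where x = "restrict (flip T x) S"])
  then show ?thesis using Q(2) by blast
qed

lemma open_dimer_cells_cover: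
  fixes \<Gamma> :: "('v, 'e) multigraph"
  defines "X \<equiv> dimer_complex \<Gamma>"
  shows "(\<Union>Q\<in>cells X. char_map X Q ` open_cube (coords X Q)) = dimer_points \<Gamma>"
proof
  show "(\<Union>Q\<in>cells X. char_map X Q ` open_cube (coords X Q)) \<subseteq> dimer_points \<Gamma>"
  proof
    fix p assume "p \<in> (\<Union>Q\<in>cells X. char_map X Q ` open_cube (coords X Q))"
    then obtain Q where Q: "Q \<in> cells X" "p \<in> char_map X Q ` open_cube (coords X Q)" by blast
    then show "p \<in> dimer_points \<Gamma>"
      using open_cube_subset_cube unfolding X_def dimer_points_def
      by (elim dimer_cell_cases) (simp, blast)
  qed
  show "dimer_points \<Gamma> \<subseteq> (\<Union>Q\<in>cells X. char_map X Q ` open_cube (coords X Q))"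
  proof
    fix p assume "p \<in> dimer_points \<Gamma>"
    then obtain A S x where p: "p = glued_point \<Gamma> (A, S, x)" "(A, S) \<in> dimer_cubes \<Gamma>" "x \<in> cube S"
      unfolding dimer_points_def by blast
    note face = glued_point_open_face[OF dimer_cubes_imp_based[OF p(2)] p(3)]
    show "p \<in> (\<Union>Q\<in>cells X. char_map X Q ` open_cube (coords X Q))"
      unfolding p(1) face(1) X_def
      by (rule glued_point_in_open_dimer_cell[OF dimer_cubes_face[OF p(2)] face(2)]) auto
  qed
qed

lemma closed_dimer_cells_cover:
  fixes \<Gamma> :: "('v, 'e) multigraph"
  defines "X \<equiv> dimer_complex \<Gamma>"
  shows "(\<Union>Q\<in>cells X. char_map X Q ` cube (coords X Q)) = dimer_points \<Gamma>"
proof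
  show "dimer_points \<Gamma> \<subseteq> (\<Union>Q\<in>cells X. char_map X Q ` cube (coords X Q))"
    using open_cube_subset_cube unfolding X_def open_dimer_cells_cover[symmetric] by fast
  show "(\<Union>Q\<in>cells X. char_map X Q ` cube (coords X Q)) \<subseteq> dimer_points \<Gamma>"
  proof
    fix p assume "p \<in> (\<Union>Q\<in>cells X. char_map X Q ` cube (coords X Q))"
    then obtain Q where Q: "Q \<in> cells X" "p \<in> char_map X Q ` cube (coords X Q)" by blast
    then show "p \<in> dimer_points \<Gamma>"
      unfolding X_def dimer_points_def by (elim dimer_cell_cases) (simp, blast)
  qed
qed

text \<open>Reflections are isometries, and the dropped coordinate is constant on the facet.\<close>

lemma restrict_flip_facet_isometry:
  assumes "finite S" "i \<in> S" "\<epsilon> \<in> {0, 1}"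
  shows "cube_isometry S (S - {i}) (\<lambda>x. restrict (flip T x) (S - {i}))
    (cube_facet S i \<epsilon>) (cube (S - {i}))"
  unfolding cube_isometry_def
proof (intro conjI ballI)
  let ?R = "S - {i}" and ?h = "\<lambda>x. restrict (flip T x) (S - {i})"
  let ?g = "\<lambda>y. restrict ((flip T y)(i := \<epsilon>)) S"
  show "bij_betw ?h (cube_facet S i \<epsilon>) (cube ?R)"
  proof (rule bij_betw_byWitness[where f' = ?g])
    show "\<forall>x\<in>cube_facet S i \<epsilon>. ?g (?h x) = x"
      using assms(2) by (auto simp: cube_facet_def cube_def flip_def fun_eq_iff PiE_iff extensional_def)
    show "\<forall>y\<in>cube ?R. ?h (?g y) = y"
      by (auto simp: cube_def flip_def fun_eq_iff PiE_iff extensional_def)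
    show "?h ` cube_facet S i \<epsilon> \<subseteq> cube ?R"
      unfolding cube_facet_def by (auto intro: flip_in_cube)
    show "?g ` cube ?R \<subseteq> cube_facet S i \<epsilon>"
    proof
      fix z assume "z \<in> ?g ` cube ?R"
      then obtain y where y: "y \<in> cube ?R" and z: "z = ?g y" by blast
      have "?g y j \<in> {0..1}" if "j \<in> S" for j
      proof (cases "j = i")
        case False
        then have "y j \<in> {0..1}" using PiE_mem[OF y[unfolded cube_def], of j] that by blast
        then show ?thesis using False that by (simp add: flip_def)
      next
        case True
        then show ?thesis using that assms(3) by fastforce
      qed
      then show "z \<in> cube_facet S i \<epsilon>"
        using assms(2) unfolding z cube_facet_def cube_def by simp
    qed
  qed
  fix x y assume xy: "x \<in> cube_facet S i \<epsilon>" "y \<in> cube_facet S i \<epsilon>"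
  have "(\<Sum>j\<in>S. (x j - y j)\<^sup>2) = (x i - y i)\<^sup>2 + (\<Sum>j\<in>?R. (x j - y j)\<^sup>2)"
    using assms by (intro sum.remove)
  also have "\<dots> = (\<Sum>j\<in>?R. (x j - y j)\<^sup>2)" using xy by (simp add: cube_facet_def)
  also have "\<dots> = (\<Sum>j\<in>?R. (?h x j - ?h y j)\<^sup>2)"
    by (intro sum.cong) (auto simp: flip_def power2_commute)
  finally show "L2_set (\<lambda>j. ?h x j - ?h y j) ?R = L2_set (\<lambda>i. x i - y i) S"
    unfolding L2_set_def by simp
qed

text \<open>The facet is represented by a based cube with one direction less; the isometry also has to account
for the base vertex \<open>T'\<close> at which the map of its cell happens to be based.\<close>

lemma dimer_cell_facet:
  assumes "Q \<in> cells (dimer_complex \<Gamma>)" "i \<in> coords (dimer_complex \<Gamma>) Q" "\<epsilon> \<in> {0, 1}"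
  defines "X \<equiv> dimer_complex \<Gamma>"
  shows "\<exists>d\<in>cells X. \<exists>h. card (coords X Q) = Suc (card (coords X d)) \<and>
    cube_isometry (coords X Q) (coords X d) h (cube_facet (coords X Q) i \<epsilon>) (cube (coords X d)) \<and>
    (\<forall>x\<in>cube_facet (coords X Q) i \<epsilon>. char_map X Q x = char_map X d (h x))"
proof -
  obtain A S where Q: "(A, S) \<in> dimer_cubes \<Gamma>" "coords X Q = S"
    "char_map X Q = (\<lambda>x. glued_point \<Gamma> (A, S, x))"
    using assms(1) unfolding X_def by (rule dimer_cell_cases)
  note bc = dimer_cubes_imp_based[OF Q(1)]
  have i: "i \<in> S" using assms(2) Q(2) by (simp add: X_def)
  have fin: "finite S" by (rule based_cubesD(2)[OF bc])
  define T where "T = (if \<epsilon> = 1 then {i} else {})"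
  let ?R = "S - {i}" and ?d = "cube_of \<Gamma> (shift T A) (S - {i})"
  have "(shift T A, ?R) \<in> dimer_cubes \<Gamma>"
    using i by (intro dimer_cubes_face[OF Q(1)]) (auto simp: T_def)
  then obtain T' where d: "T' \<subseteq> ?R" "?d \<in> cells X" "coords X ?d = ?R"
    "char_map X ?d = (\<lambda>x. glued_point \<Gamma> (shift T' (shift T A), ?R, x))"
    unfolding X_def by (rule dimer_cell_of_cube)
  let ?h = "\<lambda>x. restrict (flip T' x) ?R"
  have "card S = Suc (card ?R)" using fin i by (rule card.remove)
  moreover have "glued_point \<Gamma> (A, S, x) = glued_point \<Gamma> (shift T' (shift T A), ?R, ?h x)"
    if "x \<in> cube_facet S i \<epsilon>" for x
    using that d(1) i assms(3)
    by (intro glued_point_face[OF bc]) (auto simp: cube_facet_def T_def)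
  ultimately show ?thesis
    using restrict_flip_facet_isometry[OF fin i assms(3), of T'] unfolding Q
    by (intro bexI[OF _ d(2)] exI[of _ ?h]) (simp add: d)
qed

section \<open>The weak topology\<close>

lemma topspace_cube_topology [simp]: "topspace (cube_topology S) = cube S"
  by (simp add: cube_topology_def cube_def)

lemma openin_group_topology:
  "openin (group_topology \<Gamma>) U \<longleftrightarrow> U \<subseteq> group_points \<Gamma> \<and>
     (\<forall>(A, S)\<in>based_cubes \<Gamma>. openin (cube_topology S) {x \<in> cube S. glued_point \<Gamma> (A, S, x) \<in> U})"
proof -
  let ?P = "\<lambda>A S U. {x \<in> cube S. glued_point \<Gamma> (A, S, x) \<in> U}"
  let ?L = "\<lambda>U. U \<subseteq> group_points \<Gamma> \<and> (\<forall>(A, S)\<in>based_cubes \<Gamma>. openin (cube_topology S) (?P A S U))"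
  have "istopology ?L"
    unfolding istopology_def
  proof (intro conjI allI impI)
    fix U V assume UV: "?L U" "?L V"
    then show "U \<inter> V \<subseteq> group_points \<Gamma>" by blast
    have "?P A S (U \<inter> V) = ?P A S U \<inter> ?P A S V" for A S by blast
    then show "\<forall>(A, S)\<in>based_cubes \<Gamma>. openin (cube_topology S) (?P A S (U \<inter> V))"
      using UV by (auto intro!: openin_Int)
  next
    fix \<K> assume \<K>: "\<forall>K\<in>\<K>. ?L K"
    then show "\<Union>\<K> \<subseteq> group_points \<Gamma>" by blast
    have "?P A S (\<Union>\<K>) = (\<Union>K\<in>\<K>. ?P A S K)" for A S by blast
    then show "\<forall>(A, S)\<in>based_cubes \<Gamma>. openin (cube_topology S) (?P A S (\<Union>\<K>))"
      using \<K> by (auto intro!: openin_Union)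
  qed
  then show ?thesis unfolding group_topology_def by simp
qed

lemma topspace_group_topology: "topspace (group_topology \<Gamma>) = group_points \<Gamma>"
proof (rule subset_antisym)
  show "topspace (group_topology \<Gamma>) \<subseteq> group_points \<Gamma>"
    using openin_group_topology openin_topspace by blast
  have "{x \<in> cube S. glued_point \<Gamma> (A, S, x) \<in> group_points \<Gamma>} = topspace (cube_topology S)"
    if "(A, S) \<in> based_cubes \<Gamma>" for A S
    using that by (auto simp: group_points_def)
  then have "openin (group_topology \<Gamma>) (group_points \<Gamma>)"
    unfolding openin_group_topology by (auto simp del: topspace_cube_topology)
  then show "group_points \<Gamma> \<subseteq> topspace (group_topology \<Gamma>)" by (rule openin_subset)
qed

text \<open>Passing to a face and changing the base vertex are continuous in the coordinates.\<close>

lemma continuous_map_restrict_flip: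
  assumes "R \<subseteq> S"
  shows "continuous_map (cube_topology S) (cube_topology R) (\<lambda>x. restrict (flip T x) R)"
proof -
  have "continuous_map (cube_topology S) (top_of_set {0..1}) (\<lambda>x. restrict (flip T x) R k)"
    if "k \<in> R" for k
  proof -
    have proj: "continuous_map (cube_topology S) (top_of_set {0..1}) (\<lambda>x. x k)"
      unfolding cube_topology_def using that assms by (intro continuous_map_product_projection) blast
    have "continuous_map (top_of_set {0..1}) (top_of_set {0..1}) (\<lambda>u::real. 1 - u)"
      by (auto simp: continuous_map_in_subtopology intro!: continuous_intros)
    then have "continuous_map (cube_topology S) (top_of_set {0..1}) ((\<lambda>u. 1 - u) \<circ> (\<lambda>x. x k))"
      by (rule continuous_map_compose[OF proj])
    then show ?thesis using proj that by (simp add: flip_def comp_def)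
  qed
  moreover have "(\<lambda>x. restrict (flip T x) R) \<in> topspace (cube_topology S) \<rightarrow> extensional R"
    by simp
  ultimately show ?thesis
    unfolding cube_topology_def[of R] continuous_map_componentwise by blast
qed

lemma closedin_cube_face:
  "closedin (cube_topology S) {x \<in> cube S. \<forall>s\<in>S - R. x s = (if s \<in> T then 1 else 0)}"
proof -
  let ?F = "\<lambda>s. if s \<in> R then {0..1} else {if s \<in> T then 1 else 0 :: real}"
  have "{x \<in> cube S. \<forall>s\<in>S - R. x s = (if s \<in> T then 1 else 0)} = PiE S ?F"
  proof (intro equalityI subsetI)
    fix x assume x: "x \<in> PiE S ?F"
    have *: "x s \<in> ?F s" if "s \<in> S" for s using x that by (rule PiE_mem)
    have "x s \<in> {0..1}" if "s \<in> S" for s using *[OF that] by (simp split: if_splits)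
    moreover have "x s = (if s \<in> T then 1 else 0)" if "s \<in> S - R" for s using *[of s] that by simp
    ultimately show "x \<in> {x \<in> cube S. \<forall>s\<in>S - R. x s = (if s \<in> T then 1 else 0)}"
      using x by (simp add: cube_def PiE_iff)
  qed (simp add: cube_def PiE_iff)
  moreover have "closedin (top_of_set {0..1}) (?F s)" for s
    by (auto intro!: closed_subset)
  ultimately show ?thesis
    unfolding cube_topology_def by (simp only: closedin_product_topology) blast
qed

text \<open>A point of the dimer complex is interior to a cube with all vertices in the set of dimer coverings.
Since a point determines the cube to which it is interior, the dimer complex meets a cube of the
ambient complex in a union of faces of that cube, each of which is itself a cell of the dimer
complex.\<close>

lemma dimer_cubes_open_face:
  assumes "(A, S) \<in> based_cubes \<Gamma>" "x \<in> cube S" "glued_point \<Gamma> (A, S, x) \<in> dimer_points \<Gamma>"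
  shows "(shift {s \<in> S. x s = 1} A, {s \<in> S. 0 < x s \<and> x s < 1}) \<in> dimer_cubes \<Gamma>"
proof -
  let ?T = "{s \<in> S. x s = 1}" and ?R = "{s \<in> S. 0 < x s \<and> x s < 1}"
  let ?X = "dimer_complex \<Gamma>"
  note face = glued_point_open_face[OF assms(1,2)]
  have bc: "(shift ?T A, ?R) \<in> based_cubes \<Gamma>"
    by (rule based_cubes_subset[OF based_cubes_shift[OF assms(1)]]) auto
  obtain Q where Q: "Q \<in> cells ?X"
    "glued_point \<Gamma> (A, S, x) \<in> char_map ?X Q ` open_cube (coords ?X Q)"
    using assms(3) unfolding open_dimer_cells_cover[symmetric] by blast
  obtain B R where B: "(B, R) \<in> dimer_cubes \<Gamma>" "coords ?X Q = R"
    "char_map ?X Q = (\<lambda>x. glued_point \<Gamma> (B, R, x))"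
    using Q(1) by (rule dimer_cell_cases)
  obtain y where y: "y \<in> open_cube R"
    "glued_point \<Gamma> (B, R, y) = glued_point \<Gamma> (shift ?T A, ?R, restrict x ?R)"
    using Q(2) unfolding B(2,3) face(1) by force
  from dimer_cubes_imp_based[OF B(1)] y(1) bc face(2) y(2)
  obtain T where "?R = R" "T \<subseteq> R" "shift ?T A = shift T B"
    by (rule glued_point_open_cubes)
  then show ?thesis using dimer_cubes_face[OF B(1), of T R] by simp
qed

lemma underlying_dimer_complex:
  "underlying (dimer_complex \<Gamma>) = subtopology (group_topology \<Gamma>) (dimer_points \<Gamma>)"
  unfolding closed_dimer_cells_cover[symmetric] by (simp add: dimer_complex_def subcomplex_def group_complex_def)

lemma topspace_dimer_complex: "topspace (underlying (dimer_complex \<Gamma>)) = dimer_points \<Gamma>"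
  using dimer_points_subset_group_points
  by (auto simp: underlying_dimer_complex topspace_group_topology)

lemma closedin_preimage_dimer_cube:
  assumes U: "\<forall>Q\<in>cells (dimer_complex \<Gamma>). openin (cube_topology (coords (dimer_complex \<Gamma>) Q))
      {x \<in> cube (coords (dimer_complex \<Gamma>) Q). char_map (dimer_complex \<Gamma>) Q x \<in> U}"
    and "(B, R) \<in> dimer_cubes \<Gamma>"
  shows "closedin (cube_topology R) {y \<in> cube R. glued_point \<Gamma> (B, R, y) \<in> dimer_points \<Gamma> - U}"
proof -
  let ?X = "dimer_complex \<Gamma>" and ?Q = "cube_of \<Gamma> B R"
  obtain T where Q: "T \<subseteq> R" "?Q \<in> cells ?X" "coords ?X ?Q = R"
    "char_map ?X ?Q = (\<lambda>x. glued_point \<Gamma> (shift T B, R, x))"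
    by (rule dimer_cell_of_cube[OF assms(2)])
  let ?W = "{x \<in> cube R. glued_point \<Gamma> (shift T B, R, x) \<in> U}"
  let ?h = "\<lambda>y. restrict (flip T y) R"
  have "openin (cube_topology R) ?W" using bspec[OF U Q(2)] by (simp only: Q(3,4))
  then have "openin (cube_topology R) {y \<in> topspace (cube_topology R). ?h y \<in> ?W}"
    by (intro openin_continuous_map_preimage[OF continuous_map_restrict_flip]) simp_all
  then have "openin (cube_topology R) {y \<in> cube R. ?h y \<in> ?W}"
    by (simp only: topspace_cube_topology)
  then have "closedin (cube_topology R) (cube R - {y \<in> cube R. ?h y \<in> ?W})"
    using closedin_topspace[of "cube_topology R"] by (simp add: closedin_diff)
  also have "cube R - {y \<in> cube R. ?h y \<in> ?W}
      = {y \<in> cube R. glued_point \<Gamma> (B, R, y) \<in> dimer_points \<Gamma> - U}"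
  proof -
    have "glued_point \<Gamma> (shift T B, R, ?h y) = glued_point \<Gamma> (B, R, y)" if "y \<in> cube R" for y
      using glued_point_rebase[OF dimer_cubes_imp_based[OF assms(2)] that Q(1)] by simp
    moreover have "?h y \<in> cube R" if "y \<in> cube R" for y
      using that by (rule flip_in_cube) simp
    moreover have "glued_point \<Gamma> (B, R, y) \<in> dimer_points \<Gamma>" if "y \<in> cube R" for y
      using assms(2) that unfolding dimer_points_def by blast
    ultimately show ?thesis by auto
  qed
  finally show ?thesis .
qed

text \<open>Here the subspace topology is compared with the weak one: a set closed in each
cell of the dimer complex has to have closed preimage in every cube of the ambient complex, also in
those that are not cells of the dimer complex.  The preimage is the union, over the finitely many
faces that belong to the dimer complex, of closed subsets of these faces.\<close>

lemma closedin_preimage_based_cube: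
  assumes U: "\<forall>Q\<in>cells (dimer_complex \<Gamma>). openin (cube_topology (coords (dimer_complex \<Gamma>) Q))
      {x \<in> cube (coords (dimer_complex \<Gamma>) Q). char_map (dimer_complex \<Gamma>) Q x \<in> U}"
    and bc: "(A, S) \<in> based_cubes \<Gamma>"
  shows "closedin (cube_topology S) {x \<in> cube S. glued_point \<Gamma> (A, S, x) \<in> dimer_points \<Gamma> - U}"
proof -
  let ?faces = "{(T, R). T \<subseteq> S \<and> R \<subseteq> S \<and> T \<inter> R = {} \<and> (shift T A, R) \<in> dimer_cubes \<Gamma>}"
  let ?on = "\<lambda>T R. {x \<in> cube S. \<forall>s\<in>S - R. x s = (if s \<in> T then 1 else 0)}"
  let ?C = "\<lambda>T R. {y \<in> cube R. glued_point \<Gamma> (shift T A, R, y) \<in> dimer_points \<Gamma> - U}"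
  let ?pre = "\<lambda>T R. {x \<in> cube S. restrict x R \<in> ?C T R}"
  have face: "glued_point \<Gamma> (A, S, x) = glued_point \<Gamma> (shift T A, R, restrict x R)"
    if "T \<subseteq> S" "R \<subseteq> S" "T \<inter> R = {}" "x \<in> ?on T R" for T R x
    using that glued_point_face[OF bc, of x R T "{}"] by auto
  have "closedin (cube_topology S) (?on T R \<inter> ?pre T R)" if "(T, R) \<in> ?faces" for T R
  proof (intro closedin_Int closedin_cube_face)
    have "closedin (cube_topology R) (?C T R)"
      using that by (intro closedin_preimage_dimer_cube[OF U]) auto
    moreover have "R \<subseteq> S" using that by blast
    ultimately have "closedin (cube_topology S)
        {x \<in> topspace (cube_topology S). restrict (flip {} x) R \<in> ?C T R}"
      by (intro closedin_continuous_map_preimage[OF continuous_map_restrict_flip])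
    then show "closedin (cube_topology S) (?pre T R)"
      by (simp only: flip_empty topspace_cube_topology)
  qed
  moreover have "finite ?faces"
    by (rule finite_subset[of _ "Pow S \<times> Pow S"]) (use based_cubesD(2)[OF bc] in auto)
  ultimately have "closedin (cube_topology S) (\<Union>((\<lambda>(T, R). ?on T R \<inter> ?pre T R) ` ?faces))"
    by (intro closedin_Union) auto
  also have "\<Union>((\<lambda>(T, R). ?on T R \<inter> ?pre T R) ` ?faces)
      = {x \<in> cube S. glued_point \<Gamma> (A, S, x) \<in> dimer_points \<Gamma> - U}"
  proof (intro equalityI subsetI)
    fix x assume "x \<in> \<Union>((\<lambda>(T, R). ?on T R \<inter> ?pre T R) ` ?faces)"
    then obtain T R where TR: "(T, R) \<in> ?faces" "x \<in> ?on T R" "x \<in> ?pre T R" by blast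
    then have "glued_point \<Gamma> (A, S, x) = glued_point \<Gamma> (shift T A, R, restrict x R)"
      by (intro face) auto
    then show "x \<in> {x \<in> cube S. glued_point \<Gamma> (A, S, x) \<in> dimer_points \<Gamma> - U}"
      using TR(3) by simp
  next
    fix x assume x: "x \<in> {x \<in> cube S. glued_point \<Gamma> (A, S, x) \<in> dimer_points \<Gamma> - U}"
    let ?T = "{s \<in> S. x s = 1}" and ?R = "{s \<in> S. 0 < x s \<and> x s < 1}"
    have xS: "x \<in> cube S" using x by simp
    have "(shift ?T A, ?R) \<in> dimer_cubes \<Gamma>"
      using x by (intro dimer_cubes_open_face[OF bc]) auto
    then have TR: "(?T, ?R) \<in> ?faces" by auto
    have bounds: "0 \<le> x s \<and> x s \<le> 1" if "s \<in> S" for s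
      using PiE_mem[OF xS[unfolded cube_def] that] by simp
    have "x s = (if s \<in> ?T then 1 else 0)" if "s \<in> S - ?R" for s
      using bounds[of s] that by auto
    then have on: "x \<in> ?on ?T ?R" using xS by blast
    have "glued_point \<Gamma> (A, S, x) = glued_point \<Gamma> (shift ?T A, ?R, restrict x ?R)"
      by (rule face[OF _ _ _ on]) auto
    moreover have "restrict x ?R \<in> cube ?R" using xS by (rule restrict_in_cube) auto
    ultimately have "x \<in> ?pre ?T ?R" using x by simp
    then show "x \<in> \<Union>((\<lambda>(T, R). ?on T R \<inter> ?pre T R) ` ?faces)"
      using TR on by blast
  qed
  finally show ?thesis .
qed

text \<open>The underlying space of a subcomplex is a subspace of the ambient space, while the definition of a
cubed complex requires the weak topology; the two agree.\<close>

lemma openin_dimer_complex_iff: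
  fixes \<Gamma> :: "('v, 'e) multigraph"
  defines "X \<equiv> dimer_complex \<Gamma>"
  shows "openin (underlying X) U \<longleftrightarrow> U \<subseteq> topspace (underlying X) \<and>
    (\<forall>Q\<in>cells X. openin (cube_topology (coords X Q)) {x \<in> cube (coords X Q). char_map X Q x \<in> U})"
    (is "?lhs \<longleftrightarrow> ?sub \<and> ?weak")
proof (intro iffI conjI)
  assume ?lhs
  then show ?sub by (rule openin_subset)
  obtain V where V: "openin (group_topology \<Gamma>) V" "U = V \<inter> dimer_points \<Gamma>"
    using \<open>?lhs\<close> unfolding X_def underlying_dimer_complex openin_subtopology by blast
  show ?weak
  proof
    fix Q assume Q: "Q \<in> cells X"
    obtain A S where AS: "(A, S) \<in> dimer_cubes \<Gamma>" "coords X Q = S"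
      "char_map X Q = (\<lambda>x. glued_point \<Gamma> (A, S, x))"
      using Q unfolding X_def by (rule dimer_cell_cases)
    have "openin (cube_topology S) {x \<in> cube S. glued_point \<Gamma> (A, S, x) \<in> V}"
      using V(1) dimer_cubes_imp_based[OF AS(1)] unfolding openin_group_topology by blast
    also have "{x \<in> cube S. glued_point \<Gamma> (A, S, x) \<in> V} = {x \<in> cube S. glued_point \<Gamma> (A, S, x) \<in> U}"
      unfolding V(2) dimer_points_def using AS(1) by blast
    finally show "openin (cube_topology (coords X Q)) {x \<in> cube (coords X Q). char_map X Q x \<in> U}"
      unfolding AS(2,3) .
  qed
next
  assume asm: "?sub \<and> ?weak"
  \<comment> \<open>The largest subset of the ambient space with trace \<open>U\<close> on the dimer complex.\<close>
  let ?V = "group_points \<Gamma> - (dimer_points \<Gamma> - U)"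
  have "openin (cube_topology S) {x \<in> cube S. glued_point \<Gamma> (A, S, x) \<in> ?V}"
    if "(A, S) \<in> based_cubes \<Gamma>" for A S
  proof -
    have "closedin (cube_topology S) {x \<in> cube S. glued_point \<Gamma> (A, S, x) \<in> dimer_points \<Gamma> - U}"
      using asm that unfolding X_def by (intro closedin_preimage_based_cube) auto
    then have "openin (cube_topology S)
        (cube S - {x \<in> cube S. glued_point \<Gamma> (A, S, x) \<in> dimer_points \<Gamma> - U})"
      using openin_topspace[of "cube_topology S"] by (simp add: openin_diff)
    also have "cube S - {x \<in> cube S. glued_point \<Gamma> (A, S, x) \<in> dimer_points \<Gamma> - U}
        = {x \<in> cube S. glued_point \<Gamma> (A, S, x) \<in> ?V}"
      using that unfolding group_points_def by blast
    finally show ?thesis .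
  qed
  then have "openin (group_topology \<Gamma>) ?V"
    unfolding openin_group_topology by blast
  moreover have "U = ?V \<inter> dimer_points \<Gamma>"
    using asm dimer_points_subset_group_points unfolding X_def topspace_dimer_complex by blast
  ultimately show ?lhs unfolding X_def underlying_dimer_complex openin_subtopology by blast
qed

lemma cubed_complex_dimer_complex:
  assumes "is_graph \<Gamma>"
  shows "cubed_complex (dimer_complex \<Gamma>)"
  unfolding cubed_complex_def
proof (intro conjI)
  let ?X = "dimer_complex \<Gamma>"
  show "\<forall>c\<in>cells ?X. finite (coords ?X c)"
    using dimer_cell_cases dimer_cubes_imp_based based_cubesD(2) by metis
  show "\<forall>c\<in>cells ?X. inj_on (char_map ?X c) (open_cube (coords ?X c))"
    using dimer_cell_inj_on_open_cube[OF assms] by blast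
  show "\<forall>c\<in>cells ?X. \<forall>d\<in>cells ?X. c \<noteq> d \<longrightarrow>
      char_map ?X c ` open_cube (coords ?X c) \<inter> char_map ?X d ` open_cube (coords ?X d) = {}"
    using dimer_open_cells_disjoint by blast
  show "topspace (underlying ?X) = (\<Union>c\<in>cells ?X. char_map ?X c ` open_cube (coords ?X c))"
    unfolding topspace_dimer_complex open_dimer_cells_cover ..
  show "\<forall>c\<in>cells ?X. \<forall>i\<in>coords ?X c. \<forall>\<epsilon>\<in>{0, 1}. \<exists>d\<in>cells ?X. \<exists>h.
      card (coords ?X c) = Suc (card (coords ?X d)) \<and>
      cube_isometry (coords ?X c) (coords ?X d) h (cube_facet (coords ?X c) i \<epsilon>) (cube (coords ?X d)) \<and>
      (\<forall>x\<in>cube_facet (coords ?X c) i \<epsilon>. char_map ?X c x = char_map ?X d (h x))"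
    by (intro ballI) (rule dimer_cell_facet)
  show "\<forall>U. openin (underlying ?X) U \<longleftrightarrow> U \<subseteq> topspace (underlying ?X) \<and>
      (\<forall>c\<in>cells ?X. openin (cube_topology (coords ?X c)) {x \<in> cube (coords ?X c). char_map ?X c x \<in> U})"
    by (rule allI) (rule openin_dimer_complex_iff)
qed

section \<open>Directions\<close>

text \<open>The direction at the vertex \<open>A\<close> of the based cube \<open>(A, S)\<close>, with velocities \<open>v\<close>.  Basing all cubes
at the vertex in question removes the corners and signs from the description of the link.\<close>

definition ray_germ ::
  "('v, 'e) multigraph \<Rightarrow> 'e set \<Rightarrow> 'e set set \<Rightarrow> ('e set \<Rightarrow> real) \<Rightarrow> (real \<Rightarrow> 'e based_point set) set"
where
  "ray_germ \<Gamma> A S v = germ (\<lambda>t. glued_point \<Gamma> (A, S, \<lambda>s\<in>S. t * v s))"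

lemma germ_eq_iff: "germ \<gamma> = germ \<delta> \<longleftrightarrow> eventually (\<lambda>t. \<gamma> t = \<delta> t) (at_right 0)"
proof
  assume "germ \<gamma> = germ \<delta>"
  moreover have "\<gamma> \<in> germ \<gamma>" by (simp add: germ_def)
  ultimately have "\<gamma> \<in> germ \<delta>" by simp
  then show "eventually (\<lambda>t. \<gamma> t = \<delta> t) (at_right 0)" by (simp add: germ_def)
next
  assume ev: "eventually (\<lambda>t. \<gamma> t = \<delta> t) (at_right 0)"
  have "eventually (\<lambda>t. \<eta> t = \<gamma> t) (at_right 0) \<longleftrightarrow> eventually (\<lambda>t. \<eta> t = \<delta> t) (at_right 0)" for \<eta>
    by (rule eventually_subst) (use ev in \<open>auto elim: eventually_mono\<close>)
  then show "germ \<gamma> = germ \<delta>" unfolding germ_def by simp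
qed

lemma std_simplexD:
  assumes "v \<in> std_simplex S" "finite S" "s \<in> S"
  shows "0 \<le> v s" "v s \<le> 1"
proof -
  have nn: "\<And>r. r \<in> S \<Longrightarrow> 0 \<le> v r" and "(\<Sum>r\<in>S. v r) = 1"
    using assms(1) by (auto simp: std_simplex_def)
  then show "0 \<le> v s" "v s \<le> 1" using member_le_sum[of s S v] assms by auto
qed

lemma scaled_in_cube:
  assumes "v \<in> std_simplex S" "finite S" "0 \<le> t" "t \<le> 1"
  shows "(\<lambda>s\<in>S. t * v s) \<in> cube S"
proof -
  have "t * v s \<in> {0..1}" if "s \<in> S" for s
    using std_simplexD[OF assms(1,2) that] assms(3,4) mult_le_one[of t "v s"] by simp
  then show ?thesis unfolding cube_def by simp
qed

text \<open>Close to the base vertex all coordinates are small.  A flip would turn a coordinate \<open>u\<close> into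
\<open>1 - u\<close>, and not both can be small; so two rays from \<open>A\<close> coincide near \<open>A\<close> only if their
coordinates do.\<close>

lemma ray_germ_eq_iff:
  assumes bc: "(A, S) \<in> based_cubes \<Gamma>" "(A, R) \<in> based_cubes \<Gamma>"
    and v: "v \<in> std_simplex S" "w \<in> std_simplex R"
  shows "ray_germ \<Gamma> A S v = ray_germ \<Gamma> A R w \<longleftrightarrow> zero_extend S v = zero_extend R w"
proof
  note fin = based_cubesD(2)[OF bc(1)] based_cubesD(2)[OF bc(2)]
  assume "ray_germ \<Gamma> A S v = ray_germ \<Gamma> A R w"
  then have "eventually (\<lambda>t. glued_point \<Gamma> (A, S, \<lambda>s\<in>S. t * v s)
      = glued_point \<Gamma> (A, R, \<lambda>s\<in>R. t * w s)) (at_right 0)"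
    unfolding ray_germ_def germ_eq_iff .
  then obtain b :: real where b: "b > 0" and eq: "\<And>t. 0 < t \<Longrightarrow> t < b \<Longrightarrow>
      glued_point \<Gamma> (A, S, \<lambda>s\<in>S. t * v s) = glued_point \<Gamma> (A, R, \<lambda>s\<in>R. t * w s)"
    unfolding eventually_at_right_field by blast
  \<comment> \<open>Any bound below \<open>1 / 2\<close> rules out that two coordinates add up to \<open>1\<close>.\<close>
  define t where "t = min (b / 2) (1 / 4)"
  have t: "0 < t" "t < b" "t \<le> 1 / 4" using b by (auto simp: t_def)
  let ?x = "\<lambda>s\<in>S. t * v s" and ?y = "\<lambda>s\<in>R. t * w s"
  have "?x \<in> cube S" "?y \<in> cube R" using t by (auto intro!: scaled_in_cube v fin)
  then have "same_orbit (A, S, ?x) (A, R, ?y)"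
    using glued_point_eq_iff[OF bc(1) _ bc(2)] eq[OF t(1,2)] by blast
  then obtain T where T: "zero_extend R ?y = flip T (zero_extend S ?x)" by auto
  have x: "zero_extend S ?x s = t * zero_extend S v s" "zero_extend S v s \<le> 1"
    and y: "zero_extend R ?y s = t * zero_extend R w s" "zero_extend R w s \<le> 1" for s
    using std_simplexD[OF v(1) fin(1)] std_simplexD[OF v(2) fin(2)] by (auto simp: zero_extend_def)
  show "zero_extend S v = zero_extend R w"
  proof
    fix s
    have "t * zero_extend S v s \<le> 1 / 4" "t * zero_extend R w s \<le> 1 / 4"
      using mult_left_mono[OF x(2)[of s] less_imp_le[OF t(1)]]
        mult_left_mono[OF y(2)[of s] less_imp_le[OF t(1)]] t(3) by linarith+
    then have "t * zero_extend S v s = t * zero_extend R w s"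
      using fun_cong[OF T, of s] unfolding flip_def x(1) y(1) by (auto split: if_splits)
    then show "zero_extend S v s = zero_extend R w s" using t by simp
  qed
next
  note fin = based_cubesD(2)[OF bc(1)] based_cubesD(2)[OF bc(2)]
  assume ext: "zero_extend S v = zero_extend R w"
  have "glued_point \<Gamma> (A, S, \<lambda>s\<in>S. t * v s) = glued_point \<Gamma> (A, R, \<lambda>s\<in>R. t * w s)"
    if t: "0 < t" "t < 1" for t
  proof (rule glued_point_eqI[where T = "{}"])
    show "(\<lambda>s\<in>S. t * v s) \<in> cube S" "(\<lambda>s\<in>R. t * w s) \<in> cube R"
      using t by (auto intro!: scaled_in_cube v fin)
    show "zero_extend R (\<lambda>s\<in>R. t * w s) s = flip {} (zero_extend S (\<lambda>s\<in>S. t * v s)) s" for s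
      using fun_cong[OF ext, of s] by (auto simp: zero_extend_def split: if_splits)
  qed (simp_all add: bc)
  then show "ray_germ \<Gamma> A S v = ray_germ \<Gamma> A R w"
    unfolding ray_germ_def germ_eq_iff eventually_at_right_field
    by (intro exI[of _ 1]) auto
qed

lemma inj_on_ray_germ:
  assumes "(A, S) \<in> based_cubes \<Gamma>"
  shows "inj_on (ray_germ \<Gamma> A S) (std_simplex S)"
proof (rule inj_onI)
  fix v w assume vw: "v \<in> std_simplex S" "w \<in> std_simplex S" "ray_germ \<Gamma> A S v = ray_germ \<Gamma> A S w"
  then have ext: "zero_extend S v = zero_extend S w" using ray_germ_eq_iff[OF assms assms] by blast
  have "v \<in> extensional S" "w \<in> extensional S" using vw by (auto simp: std_simplex_def PiE_iff)
  then show "v = w"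
  proof (rule extensionalityI)
    show "v s = w s" if "s \<in> S" for s using fun_cong[OF ext, of s] that by (simp add: zero_extend_def)
  qed
qed

text \<open>Velocity functions that agree after extension by zero vanish outside \<open>S \<inter> R\<close>; conversely, a velocity
function that vanishes there is at home in both cubes.\<close>

lemma Int_ray_germ_simplices:
  assumes bc: "(A, S) \<in> based_cubes \<Gamma>" "(A, R) \<in> based_cubes \<Gamma>"
  shows "ray_germ \<Gamma> A S ` std_simplex S \<inter> ray_germ \<Gamma> A R ` std_simplex R
    = ray_germ \<Gamma> A S ` std_face S (S \<inter> R)"
proof (intro equalityI subsetI)
  fix q assume "q \<in> ray_germ \<Gamma> A S ` std_simplex S \<inter> ray_germ \<Gamma> A R ` std_simplex R"
  then obtain v w where v: "v \<in> std_simplex S" "q = ray_germ \<Gamma> A S v"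
    and w: "w \<in> std_simplex R" "q = ray_germ \<Gamma> A R w" by blast
  have ext: "zero_extend S v = zero_extend R w"
    using ray_germ_eq_iff[OF bc v(1) w(1)] v(2) w(2) by simp
  have "v s = 0" if "s \<in> S - S \<inter> R" for s
    using fun_cong[OF ext, of s] that by (simp add: zero_extend_def)
  then show "q \<in> ray_germ \<Gamma> A S ` std_face S (S \<inter> R)"
    using v by (auto simp: std_face_def)
next
  fix q assume "q \<in> ray_germ \<Gamma> A S ` std_face S (S \<inter> R)"
  then obtain v where v: "v \<in> std_simplex S" "\<And>s. s \<in> S - S \<inter> R \<Longrightarrow> v s = 0"
    "q = ray_germ \<Gamma> A S v" by (auto simp: std_face_def)
  note fin = based_cubesD(2)[OF bc(1)] based_cubesD(2)[OF bc(2)]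
  define w where "w = restrict (zero_extend S v) R"
  have "(\<Sum>s\<in>R. w s) = (\<Sum>s\<in>S \<inter> R. v s)"
    unfolding w_def zero_extend_def by (intro sum.mono_neutral_cong_right) (auto simp: fin)
  also have "\<dots> = (\<Sum>s\<in>S. v s)"
    using v(2) by (intro sum.mono_neutral_left) (auto simp: fin)
  finally have "(\<Sum>s\<in>R. w s) = 1" using v(1) by (simp add: std_simplex_def)
  moreover have "w \<in> (\<Pi>\<^sub>E s\<in>R. {0..})"
    unfolding w_def zero_extend_def using std_simplexD[OF v(1) fin(1)] by auto
  ultimately have w: "w \<in> std_simplex R" by (simp add: std_simplex_def)
  have "zero_extend S v = zero_extend R w"
    using v(2) by (auto simp: w_def zero_extend_def fun_eq_iff)
  then have "q = ray_germ \<Gamma> A R w" using ray_germ_eq_iff[OF bc v(1) w] v(3) by simp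
  then show "q \<in> ray_germ \<Gamma> A S ` std_simplex S \<inter> ray_germ \<Gamma> A R ` std_simplex R"
    using v w by blast
qed

section \<open>Links of the dimer complex\<close>

abbreviation vertex_point :: "('v, 'e) multigraph \<Rightarrow> 'e set \<Rightarrow> 'e based_point set" where
  "vertex_point \<Gamma> A \<equiv> glued_point \<Gamma> (A, {}, \<lambda>_. undefined)"

lemma restrict_empty: "restrict x {} = (\<lambda>_. undefined)"
  by (simp add: restrict_def)

lemma vertex_point_eq_iff:
  assumes "(A, {}) \<in> based_cubes \<Gamma>" "(B, {}) \<in> based_cubes \<Gamma>"
  shows "vertex_point \<Gamma> A = vertex_point \<Gamma> B \<longleftrightarrow> A = B"
proof
  assume eq: "vertex_point \<Gamma> A = vertex_point \<Gamma> B"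
  have "(\<lambda>_. undefined) \<in> open_cube {}" by (simp add: open_cube_def)
  with assms eq obtain T where "T \<subseteq> {}" "B = shift T A"
    using glued_point_open_cubes[of A "{}" \<Gamma> "\<lambda>_. undefined" B "{}" "\<lambda>_. undefined"] by blast
  then show "A = B" by simp
qed simp

lemma zero_cells_dimer_complex:
  assumes "p \<in> zero_cells (dimer_complex \<Gamma>)"
  obtains A where "(A, {}) \<in> dimer_cubes \<Gamma>" "p = vertex_point \<Gamma> A"
proof -
  obtain Q where Q: "Q \<in> cells (dimer_complex \<Gamma>)" "coords (dimer_complex \<Gamma>) Q = {}"
    "p \<in> char_map (dimer_complex \<Gamma>) Q ` cube {}"
    using assms by (auto simp: zero_cells_def)
  obtain A S where A: "(A, S) \<in> dimer_cubes \<Gamma>" "coords (dimer_complex \<Gamma>) Q = S"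
    "char_map (dimer_complex \<Gamma>) Q = (\<lambda>x. glued_point \<Gamma> (A, S, x))"
    using Q(1) by (rule dimer_cell_cases)
  have "S = {}" using A(2) Q(2) by simp
  then show ?thesis using that[of A] A Q(3) by (simp add: cube_def)
qed

lemma cube_corners_subset_cube: "cube_corners S \<subseteq> cube S"
  unfolding cube_corners_def cube_def by (intro PiE_mono) auto

lemma ray_in_cube:
  assumes "a \<in> cube_corners S" "v \<in> std_simplex S" "finite S" "0 < t" "t < 1"
  shows "ray S a v t \<in> cube S"
proof -
  have "a s + t * (1 - 2 * a s) * v s \<in> {0..1}" if "s \<in> S" for s
  proof -
    have "a s = 0 \<or> a s = 1" using PiE_mem[OF assms(1)[unfolded cube_corners_def] that] by simp
    moreover have "0 \<le> t * v s" "t * v s \<le> 1"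
      using std_simplexD[OF assms(2,3) that] assms(4,5) by (auto intro: mult_le_one)
    ultimately show ?thesis by auto
  qed
  then show ?thesis unfolding ray_def cube_def by simp
qed

text \<open>A corner of a cell at the vertex \<open>A\<close> amounts to a based cube with base \<open>A\<close>: rebasing by the
coordinates of the corner that equal \<open>1\<close> moves the corner to the origin, and makes all rays that
leave it have positive velocities.\<close>

lemma link_data_dimer_complex:
  assumes "(c, a) \<in> link_data (dimer_complex \<Gamma>) (vertex_point \<Gamma> A)" "(A, {}) \<in> dimer_cubes \<Gamma>"
  defines "S \<equiv> coords (dimer_complex \<Gamma>) c"
  shows "(A, S) \<in> dimer_cubes \<Gamma>" "S \<noteq> {}"
    "v \<in> std_simplex S \<Longrightarrow> direction (dimer_complex \<Gamma>) c a v = ray_germ \<Gamma> A S v"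
proof -
  have c: "c \<in> cells (dimer_complex \<Gamma>)" "S \<noteq> {}" "a \<in> cube_corners S"
    "char_map (dimer_complex \<Gamma>) c a = vertex_point \<Gamma> A"
    using assms(1) unfolding link_data_def S_def by auto
  show "S \<noteq> {}" by (rule c(2))
  obtain B S' where B: "(B, S') \<in> dimer_cubes \<Gamma>" "coords (dimer_complex \<Gamma>) c = S'"
    "char_map (dimer_complex \<Gamma>) c = (\<lambda>x. glued_point \<Gamma> (B, S', x))"
    using c(1) by (rule dimer_cell_cases)
  have S': "S' = S" using B(2) by (simp add: S_def)
  note B = B[unfolded S']
  note bc = dimer_cubes_imp_based[OF B(1)]
  note fin = based_cubesD(2)[OF bc]
  have aS: "a \<in> cube S" using c(3) cube_corners_subset_cube by blast
  have a01: "a s = 0 \<or> a s = 1" if "s \<in> S" for s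
    using PiE_mem[OF c(3)[unfolded cube_corners_def] that] by simp
  define T where "T = {s \<in> S. a s = 1}"
  have TS: "T \<subseteq> S" by (auto simp: T_def)
  have "a s = (if s \<in> T then 1 else 0)" if "s \<in> S - {}" for s
    using a01[of s] that by (auto simp: T_def)
  then have "glued_point \<Gamma> (B, S, a) = vertex_point \<Gamma> (shift T B)"
    using glued_point_face[OF bc aS, of "{}" T "{}"] TS by (simp add: restrict_empty)
  then have "vertex_point \<Gamma> (shift T B) = vertex_point \<Gamma> A"
    using c(4) B(3) by simp
  moreover have "(shift T B, {}) \<in> based_cubes \<Gamma>"
    by (rule dimer_cubes_imp_based[OF dimer_cubes_face[OF B(1) TS]]) simp
  ultimately have A: "A = shift T B"
    using vertex_point_eq_iff dimer_cubes_imp_based[OF assms(2)] by metis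
  show dc: "(A, S) \<in> dimer_cubes \<Gamma>"
    unfolding A by (rule dimer_cubes_face[OF B(1) TS]) simp
  assume v: "v \<in> std_simplex S"
  have "glued_point \<Gamma> (B, S, ray S a v t) = glued_point \<Gamma> (A, S, \<lambda>s\<in>S. t * v s)"
    if "0 < t" "t < 1" for t
  proof (rule glued_point_eqI[OF bc _ dimer_cubes_imp_based[OF dc] _ _ A])
    show "ray S a v t \<in> cube S" by (rule ray_in_cube[OF c(3) v fin that])
    show "(\<lambda>s\<in>S. t * v s) \<in> cube S" using that by (intro scaled_in_cube v fin) auto
    show "finite T" using TS fin by (rule finite_subset)
    show "zero_extend S (\<lambda>s\<in>S. t * v s) s = flip T (zero_extend S (ray S a v t)) s" for s
      using a01[of s] by (auto simp: zero_extend_def flip_def ray_def T_def)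
  qed
  then show "direction (dimer_complex \<Gamma>) c a v = ray_germ \<Gamma> A S v"
    unfolding direction_def ray_germ_def germ_eq_iff eventually_at_right_field B(2,3)
    by (intro exI[of _ 1]) auto
qed

lemma link_data_of_dimer_cube:
  assumes "(A, S) \<in> dimer_cubes \<Gamma>" "S \<noteq> {}"
  obtains c a where "(c, a) \<in> link_data (dimer_complex \<Gamma>) (vertex_point \<Gamma> A)"
    "coords (dimer_complex \<Gamma>) c = S"
proof -
  obtain T where c: "T \<subseteq> S" "cube_of \<Gamma> A S \<in> cells (dimer_complex \<Gamma>)"
    "coords (dimer_complex \<Gamma>) (cube_of \<Gamma> A S) = S"
    "char_map (dimer_complex \<Gamma>) (cube_of \<Gamma> A S) = (\<lambda>x. glued_point \<Gamma> (shift T A, S, x))"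
    using assms(1) by (rule dimer_cell_of_cube)
  define a where "a = (\<lambda>s\<in>S. if s \<in> T then 1 else 0 :: real)"
  have a: "a \<in> cube_corners S" by (simp add: a_def cube_corners_def)
  have bc: "(shift T A, S) \<in> based_cubes \<Gamma>"
    by (rule based_cubes_shift[OF dimer_cubes_imp_based[OF assms(1)] c(1)])
  have "glued_point \<Gamma> (shift T A, S, a) = vertex_point \<Gamma> A"
    using glued_point_face[OF bc, of a "{}" T "{}"] a cube_corners_subset_cube[of S] c(1)
    by (auto simp: a_def restrict_empty)
  then show ?thesis using that[of "cube_of \<Gamma> A S" a] c a assms(2) by (simp add: link_data_def)
qed

lemma link_simplicial_dimer_complex:
  assumes "p \<in> zero_cells (dimer_complex \<Gamma>)"
  shows "link_simplicial (dimer_complex \<Gamma>) p"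
proof -
  let ?X = "dimer_complex \<Gamma>"
  obtain A where A: "(A, {}) \<in> dimer_cubes \<Gamma>" "p = vertex_point \<Gamma> A"
    using assms by (rule zero_cells_dimer_complex)
  have bc: "(A, coords ?X c) \<in> based_cubes \<Gamma>" if "(c, a) \<in> link_data ?X p" for c a
    using link_data_dimer_complex(1)[OF that[unfolded A(2)] A(1)] by (rule dimer_cubes_imp_based)
  have dir: "direction ?X c a v = ray_germ \<Gamma> A (coords ?X c) v"
    if "(c, a) \<in> link_data ?X p" "v \<in> std_simplex (coords ?X c)" for c a v
    using that link_data_dimer_complex(3) A by metis
  have simplex: "link_simplex ?X c a = ray_germ \<Gamma> A (coords ?X c) ` std_simplex (coords ?X c)"
    if "(c, a) \<in> link_data ?X p" for c a
    unfolding link_simplex_def using dir[OF that] by (intro image_cong) auto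
  have face: "link_face ?X c a J = ray_germ \<Gamma> A (coords ?X c) ` std_face (coords ?X c) J"
    if "(c, a) \<in> link_data ?X p" for c a J
    unfolding link_face_def using dir[OF that] by (intro image_cong) (auto simp: std_face_def)
  show ?thesis unfolding link_simplicial_def
  proof (intro conjI ballI; clarify)
    fix c a assume ca: "(c, a) \<in> link_data ?X p"
    show "inj_on (direction ?X c a) (std_simplex (coords ?X c))"
      using inj_on_ray_germ[OF bc[OF ca]] dir[OF ca] by (subst inj_on_cong) auto
  next
    fix c a d b assume ca: "(c, a) \<in> link_data ?X p" and db: "(d, b) \<in> link_data ?X p"
    let ?J = "coords ?X c \<inter> coords ?X d"
    have "link_simplex ?X c a \<inter> link_simplex ?X d b = link_face ?X c a ?J"
      unfolding simplex[OF ca] simplex[OF db] face[OF ca]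
      by (rule Int_ray_germ_simplices[OF bc[OF ca] bc[OF db]])
    moreover have "link_simplex ?X c a \<inter> link_simplex ?X d b = link_face ?X d b ?J"
      unfolding simplex[OF ca] simplex[OF db] face[OF db]
      using Int_ray_germ_simplices[OF bc[OF db] bc[OF ca]] by (simp only: Int_commute)
    ultimately show "\<exists>J J'. J \<subseteq> coords ?X c \<and> J' \<subseteq> coords ?X d \<and>
        link_simplex ?X c a \<inter> link_simplex ?X d b = link_face ?X c a J \<and>
        link_simplex ?X c a \<inter> link_simplex ?X d b = link_face ?X d b J'"
      by (intro exI[of _ ?J]) simp
  qed
qed

section \<open>The flag property\<close>

text \<open>The vertex of the link at \<open>A\<close> given by the edge from \<open>A\<close> in the direction of the cycle \<open>s\<close>.\<close>

definition axis_germ :: "('v, 'e) multigraph \<Rightarrow> 'e set \<Rightarrow> 'e set \<Rightarrow> (real \<Rightarrow> 'e based_point set) set" where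
  "axis_germ \<Gamma> A s = ray_germ \<Gamma> A {s} (\<lambda>r\<in>{s}. 1)"

lemma std_face_singleton:
  assumes "finite S" "s \<in> S"
  shows "std_face S {s} = {\<lambda>r\<in>S. if r = s then 1 else 0}"
proof (intro equalityI subsetI)
  fix v assume v: "v \<in> std_face S {s}"
  then have "(\<Sum>r\<in>S. v r) = 1" and zero: "\<And>r. r \<in> S - {s} \<Longrightarrow> v r = 0" and ext: "v \<in> extensional S"
    by (auto simp: std_face_def std_simplex_def PiE_iff)
  moreover have "(\<Sum>r\<in>S. v r) = v s + (\<Sum>r\<in>S - {s}. v r)" by (rule sum.remove[OF assms])
  ultimately have "v s = 1" by simp
  then have "v r = (\<lambda>r\<in>S. if r = s then 1 else 0) r" for r
    using zero[of r] ext assms(2) by (cases "r \<in> S") (auto simp: extensional_def)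
  then show "v \<in> {\<lambda>r\<in>S. if r = s then 1 else 0}" by auto
qed (use assms in \<open>auto simp: std_face_def std_simplex_def\<close>)

lemma axis_germ_eq_ray_germ:
  assumes "(A, S) \<in> based_cubes \<Gamma>" "s \<in> S"
  shows "ray_germ \<Gamma> A S ` std_face S {s} = {axis_germ \<Gamma> A s}"
proof -
  note fin = based_cubesD(2)[OF assms(1)]
  let ?v = "\<lambda>r\<in>S. if r = s then 1 else 0 :: real"
  have "?v \<in> std_face S {s}" using std_face_singleton[OF fin assms(2)] by simp
  then have "?v \<in> std_simplex S" by (simp add: std_face_def)
  moreover have "(\<lambda>r\<in>{s}. 1) \<in> std_simplex {s}" by (simp add: std_simplex_def)
  moreover have "zero_extend S ?v = zero_extend {s} (\<lambda>r\<in>{s}. 1)"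
    using assms(2) by (auto simp: zero_extend_def fun_eq_iff)
  moreover have "(A, {s}) \<in> based_cubes \<Gamma>"
    by (rule based_cubes_subset[OF assms(1)]) (use assms(2) in simp)
  ultimately have "ray_germ \<Gamma> A S ?v = axis_germ \<Gamma> A s"
    unfolding axis_germ_def using ray_germ_eq_iff[OF assms(1)] by blast
  then show ?thesis unfolding std_face_singleton[OF fin assms(2)] by simp
qed

lemma axis_germ_inject:
  assumes "(A, {s}) \<in> based_cubes \<Gamma>" "(A, {t}) \<in> based_cubes \<Gamma>"
    and "axis_germ \<Gamma> A s = axis_germ \<Gamma> A t"
  shows "s = t"
proof -
  have "(\<lambda>r\<in>{s}. 1) \<in> std_simplex {s}" "(\<lambda>r\<in>{t}. 1) \<in> std_simplex {t}"
    by (simp_all add: std_simplex_def)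
  then have "zero_extend {s} (\<lambda>r\<in>{s}. 1) = zero_extend {t} (\<lambda>r\<in>{t}. 1)"
    using ray_germ_eq_iff[OF assms(1,2)] assms(3) unfolding axis_germ_def by blast
  from fun_cong[OF this, of s] show ?thesis by (simp add: zero_extend_def split: if_splits)
qed

text \<open>The simplices of the link of \<open>A\<close> correspond to the nonempty sets \<open>S\<close> for which all vertices of the
based cube \<open>(A, S)\<close> are dimer coverings.\<close>

lemma link_complex_dimer_complex:
  assumes "(A, {}) \<in> dimer_cubes \<Gamma>"
  shows "link_complex (dimer_complex \<Gamma>) (vertex_point \<Gamma> A)
    = {axis_germ \<Gamma> A ` S |S. (A, S) \<in> dimer_cubes \<Gamma> \<and> S \<noteq> {}}"
proof -
  let ?X = "dimer_complex \<Gamma>" and ?p = "vertex_point \<Gamma> A"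
  have vertices: "link_simplex_vertices ?X c a = axis_germ \<Gamma> A ` coords ?X c"
    if "(c, a) \<in> link_data ?X ?p" for c a
  proof -
    note ca = link_data_dimer_complex[OF that assms]
    have "link_face ?X c a {s} = {axis_germ \<Gamma> A s}" if "s \<in> coords ?X c" for s
    proof -
      have "link_face ?X c a {s} = ray_germ \<Gamma> A (coords ?X c) ` std_face (coords ?X c) {s}"
        unfolding link_face_def using ca(3) by (intro image_cong) (auto simp: std_face_def)
      then show ?thesis using axis_germ_eq_ray_germ[OF dimer_cubes_imp_based[OF ca(1)] that] by simp
    qed
    then show ?thesis unfolding link_simplex_vertices_def by auto
  qed
  show ?thesis
  proof (intro equalityI subsetI)
    fix K assume "K \<in> link_complex ?X ?p"
    then obtain c a where ca: "(c, a) \<in> link_data ?X ?p" "K = link_simplex_vertices ?X c a"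
      unfolding link_complex_def by auto
    then show "K \<in> {axis_germ \<Gamma> A ` S |S. (A, S) \<in> dimer_cubes \<Gamma> \<and> S \<noteq> {}}"
      using vertices[OF ca(1)] link_data_dimer_complex(1,2)[OF ca(1) assms] by auto
  next
    fix K assume "K \<in> {axis_germ \<Gamma> A ` S |S. (A, S) \<in> dimer_cubes \<Gamma> \<and> S \<noteq> {}}"
    then obtain S where S: "(A, S) \<in> dimer_cubes \<Gamma>" "S \<noteq> {}" "K = axis_germ \<Gamma> A ` S" by auto
    obtain c a where ca: "(c, a) \<in> link_data ?X ?p" "coords ?X c = S"
      using S(1,2) by (rule link_data_of_dimer_cube)
    have "K = link_simplex_vertices ?X c a" using vertices[OF ca(1)] ca(2) S(3) by simp
    then show "K \<in> link_complex ?X ?p" unfolding link_complex_def using ca(1) by force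
  qed
qed

text \<open>The heart of the flag property.  Being a dimer
covering is a condition on the edges at each vertex of the graph separately.  As independent cycles
have no common vertex, at a given vertex \<open>[T]A\<close> looks like \<open>[s]A\<close> if some \<open>s \<in> T\<close> passes through this
vertex, and like \<open>A\<close> otherwise.\<close>

lemma dimer_cube_of_edges:
  assumes graph: "is_graph \<Gamma>" and bc: "(A, S) \<in> based_cubes \<Gamma>"
    and A: "A \<in> dimer_coverings \<Gamma>" and edge: "\<And>s. s \<in> S \<Longrightarrow> shift {s} A \<in> dimer_coverings \<Gamma>"
  shows "(A, S) \<in> dimer_cubes \<Gamma>"
proof -
  have "shift T A \<in> dimer_coverings \<Gamma>" if T: "T \<subseteq> S" for T
    unfolding dimer_coverings_def
  proof (intro CollectI conjI ballI)
    show "shift T A \<subseteq> edges \<Gamma>" by (rule based_cubesD(1)[OF based_cubes_shift[OF bc T]])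
    fix v assume v: "v \<in> verts \<Gamma>"
    note sum = parity_sum_eq_Union[OF graph bc T]
    show "\<exists>!e. e \<in> shift T A \<and> v \<in> ends \<Gamma> e"
    proof (cases "\<exists>s\<in>T. \<exists>e\<in>s. v \<in> ends \<Gamma> e")
      case True
      then obtain s f where s: "s \<in> T" "f \<in> s" "v \<in> ends \<Gamma> f" by blast
      have "t = s" if "t \<in> T" "e \<in> t" "v \<in> ends \<Gamma> e" for t e
      proof (rule ccontr)
        assume "t \<noteq> s"
        then have "independent_edge_sets \<Gamma> s t"
          using based_cubesD(5)[OF bc] s(1) that(1) T by (auto simp: pairwise_def)
        then show False using s that by (auto simp: independent_edge_sets_def)
      qed
      then have "e \<in> shift T A \<longleftrightarrow> e \<in> shift {s} A" if "v \<in> ends \<Gamma> e" for e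
        using that s(1) unfolding shift_def sum by auto
      moreover have "\<exists>!e. e \<in> shift {s} A \<and> v \<in> ends \<Gamma> e"
      proof -
        have "shift {s} A \<in> dimer_coverings \<Gamma>" using edge s(1) T by blast
        then show ?thesis using v by (simp add: dimer_coverings_def)
      qed
      ultimately show ?thesis by (metis (no_types, lifting))
    next
      case False
      then have "e \<in> shift T A \<longleftrightarrow> e \<in> A" if "v \<in> ends \<Gamma> e" for e
        using that unfolding shift_def sum by auto
      moreover have "\<exists>!e. e \<in> A \<and> v \<in> ends \<Gamma> e"
        using A v by (auto simp: dimer_coverings_def)
      ultimately show ?thesis by (metis (no_types, lifting))
    qed
  qed
  then show ?thesis using bc by (simp add: dimer_cubes_def)
qed

text \<open>Pairwise adjacency of vertices of the link gives a square at \<open>A\<close> for any two of the cycles, so the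
cycles are pairwise independent; then they span a based cube, all vertices of which are dimer
coverings because those adjacent to \<open>A\<close> are.\<close>

lemma flag_complex_link_dimer_complex:
  assumes graph: "is_graph \<Gamma>" and "p \<in> zero_cells (dimer_complex \<Gamma>)"
  shows "flag_complex (link_complex (dimer_complex \<Gamma>) p)"
proof -
  obtain A where A: "(A, {}) \<in> dimer_cubes \<Gamma>" "p = vertex_point \<Gamma> A"
    using assms(2) by (rule zero_cells_dimer_complex)
  let ?g = "axis_germ \<Gamma> A"
  define Z where "Z = {s. (A, {s}) \<in> dimer_cubes \<Gamma>}"
  have sub: "R \<subseteq> Z" if "(A, R) \<in> dimer_cubes \<Gamma>" for R
    using dimer_cubes_face[OF that, of "{}"] by (auto simp: Z_def)
  have inj: "inj_on ?g Z"
    by (rule inj_onI) (simp add: Z_def axis_germ_inject[OF dimer_cubes_imp_based dimer_cubes_imp_based])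
  have link: "link_complex (dimer_complex \<Gamma>) p = {?g ` S |S. (A, S) \<in> dimer_cubes \<Gamma> \<and> S \<noteq> {}}"
    unfolding A(2) by (rule link_complex_dimer_complex[OF A(1)])
  show ?thesis unfolding flag_complex_def link
  proof (intro allI impI; elim conjE)
    let ?K = "{?g ` S |S. (A, S) \<in> dimer_cubes \<Gamma> \<and> S \<noteq> {}}"
    fix U assume U: "finite U" "U \<noteq> {}" "U \<subseteq> \<Union>?K" "pairwise (\<lambda>u w. {u, w} \<in> ?K) U"
    \<comment> \<open>Cycles correspond bijectively to vertices of the link, so \<open>S\<close> is \<open>U\<close> in other terms.\<close>
    define S where "S = {s \<in> Z. ?g s \<in> U}"
    have SZ: "S \<subseteq> Z" by (auto simp: S_def)
    have "U \<subseteq> ?g ` Z" using U(3) sub by blast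
    then have US: "U = ?g ` S" by (auto simp: S_def)
    have "finite S" using U(1) inj_on_subset[OF inj SZ] unfolding US by (rule finite_imageD)
    have "independent_edge_sets \<Gamma> s t" if st: "s \<in> S" "t \<in> S" "s \<noteq> t" for s t
    proof -
      have "?g s \<noteq> ?g t" using inj_onD[OF inj, of s t] st SZ by auto
      then have "{?g s, ?g t} \<in> ?K" using U(4) st unfolding US by (auto simp: pairwise_def)
      then obtain R where R: "{?g s, ?g t} = ?g ` R" "(A, R) \<in> dimer_cubes \<Gamma>" by auto
      have "r \<in> R" if "r \<in> Z" "?g r \<in> ?g ` R" for r
        using that sub[OF R(2)] inj_on_image_mem_iff[OF inj] by blast
      then have "s \<in> R" "t \<in> R" using st SZ by (auto simp flip: R(1))
      then show ?thesis
        using based_cubesD(5)[OF dimer_cubes_imp_based[OF R(2)]] st(3) by (auto simp: pairwise_def)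
    qed
    then have "pairwise (independent_edge_sets \<Gamma>) S" by (simp add: pairwise_def)
    moreover have Zs: "(A, {s}) \<in> dimer_cubes \<Gamma>" if "s \<in> S" for s using that SZ by (auto simp: Z_def)
    then have "even_cycle \<Gamma> s" if "s \<in> S" for s
      using based_cubesD(4)[OF dimer_cubes_imp_based[OF Zs[OF that]]] by simp
    moreover have "(A, {}) \<in> based_cubes \<Gamma>" using A(1) by (rule dimer_cubes_imp_based)
    ultimately have bc: "(A, S) \<in> based_cubes \<Gamma>"
      using \<open>finite S\<close> by (simp add: based_cubes_def)
    have "(A, S) \<in> dimer_cubes \<Gamma>"
    proof (rule dimer_cube_of_edges[OF graph bc])
      show "A \<in> dimer_coverings \<Gamma>" using A(1) by (auto simp: dimer_cubes_def)
      show "shift {s} A \<in> dimer_coverings \<Gamma>" if "s \<in> S" for s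
        using Zs[OF that] by (simp add: dimer_cubes_def)
    qed
    moreover have "S \<noteq> {}" using US U(2) by auto
    ultimately show "U \<in> ?K" using US by blast
  qed
qed

theorem theorem8p3:
  fixes \<Gamma> :: "('v, 'e) multigraph"
  assumes "is_graph \<Gamma>"
  shows "nonpositively_curved (dimer_complex \<Gamma>)"
  unfolding nonpositively_curved_def simple_cubed_complex_def
  using cubed_complex_dimer_complex[OF assms] link_simplicial_dimer_complex
    flag_complex_link_dimer_complex[OF assms] by blast

end
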